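(* Let $P$ be the boundary word of a prime double square and let $\alpha\in\Sigma=\{0,1,\overline{0},\overline{1}\}$. Then $\alpha\alpha\not\subseteq P$, i.e. the circular word $P$ contains no two consecutive equal letters.
   Context: Words. $\Sigma=\{0,1,\overline{0},\overline{1}\}$, whose letters encode unit steps right, up, left, down in $\mathbb{Z}^2$; conjugation exchanges $0\leftrightarrow\overline{0}$ and $1\leftrightarrow\overline{1}$. For $w=w_1\cdots w_n\in\Sigma^*$: $\overline{w}$ is obtained by conjugating each letter, $\tilde{w}=w_n\cdots w_1$ is the reversal, and $\widehat{w}=\tilde{\overline{w}}$. A palindrome is a word with $w=\tilde w$. $|w|$ is the length and $|w|_\alpha$ the number of occurrences of $\alpha$. "$x\subseteq w$" means that $x$ is a factor (contiguous subword) of $w$. Boundary words. The boundary of a polyomino is coded by a word $P$ over $\Sigma$, regarded as a circular word (defined up to the starting point; factors may wrap around), describing a closed non-self-intersecting lattice path of length at least $4$: $|P|_\alpha=|P|_{\overline\alpha}$ for $\alpha=0,1$, and no nonempty proper factor $Q$ of the circular word satisfies both $|Q|_0=|Q|_{\overline 0}$ and $|Q|_1=|Q|_{\overline 1}$. The simple square is coded by $01\overline{0}\,\overline{1}$. Double squares. A double square is a polyomino whose boundary word has two different factorizations $P=AB\widehat{A}\widehat{B}=XY\widehat{X}\widehat{Y}$ (as circular words); equivalently $P=w_1w_2\cdots w_8$ (as a circular word) with all $w_i$ nonempty, $A=w_1w_2$, $B=w_3w_4$, $\widehat{A}=w_5w_6$, $\widehat{B}=w_7w_8$, $X=w_2w_3$,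 $Y=w_4w_5$, $\widehat{X}=w_6w_7$, $\widehat{Y}=w_8w_1$. Primality. A homologous morphism is a monoid morphism $\varphi:\Sigma^*\to\Sigma^*$ with $\varphi(\widehat{A})=\widehat{\varphi(A)}$ for all $A\in\Sigma^*$. A double square with boundary word $P$ is prime if, for every homologous morphism $\varphi$ and every boundary word $U$ of a polyomino with $P=\varphi(U)$ (as circular words), either $U=P$ or $U$ is the boundary word of the simple square; here equality of boundary words is understood up to starting point and up to a permutation of $\Sigma$ commuting with conjugation (i.e. up to rotations and reflections of the plane). *)

theory Defs
  imports Main "HOL-Library.Sublist"
begin

text \<open>
  The letters \<open>0, 1\<close> and their conjugates are written \<open>East, North\<close> and \<open>West, South\<close>, after the
  unit steps of the lattice that they encode.
\<close>

datatype letter = East | North | West | South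

fun bar :: "letter \<Rightarrow> letter" where
  "bar East = West"
| "bar North = South"
| "bar West = East"
| "bar South = North"

definition hat :: "letter list \<Rightarrow> letter list" where
  "hat w = rev (map bar w)"

text \<open>
  A circular word is represented by any of its linear representatives; two lists represent the
  same circular word iff they are rotations of each other.
\<close>

definition circ_eq :: "'a list \<Rightarrow> 'a list \<Rightarrow> bool" where
  "circ_eq u v \<longleftrightarrow> (\<exists>k. rotate k u = v)"

definition circ_factor :: "'a list \<Rightarrow> 'a list \<Rightarrow> bool" where
  "circ_factor x w \<longleftrightarrow> (\<exists>k. sublist x (rotate k w))"

definition balanced :: "letter list \<Rightarrow> bool" where
  "balanced w \<longleftrightarrow> count_list w East = count_list w West \<and> count_list w North = count_list w South"

text \<open>
  The factors of full length of a circular word are its representatives, so that a factor is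
  proper iff it is shorter than the word.
\<close>

definition boundary_word :: "letter list \<Rightarrow> bool" where
  "boundary_word P \<longleftrightarrow> length P \<ge> 4 \<and> balanced P \<and>
     (\<forall>Q. circ_factor Q P \<and> Q \<noteq> [] \<and> length Q < length P \<longrightarrow> \<not> balanced Q)"

definition simple_square :: "letter list" where
  "simple_square = [East, North, West, South]"

text \<open>
  A factorization of the circular word \<open>P\<close> as \<open>A B (hat A) (hat B)\<close> consists of a starting position
  \<open>k\<close> in \<open>P\<close> and the words \<open>A, B\<close>.  The same factorization can also be read from another of its four
  blocks, starting with \<open>B (hat A) (hat B) A\<close> for instance; hence two factorizations are the same iff
  they cut the circular word at the same positions, which are taken modulo the length of \<open>P\<close>.
\<close>

definition square_factorization ::
    "letter list \<Rightarrow> nat \<Rightarrow> letter list \<Rightarrow> letter list \<Rightarrow> bool" where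
  "square_factorization P k A B \<longleftrightarrow> rotate k P = A @ B @ hat A @ hat B"

definition cut_positions ::
    "letter list \<Rightarrow> nat \<Rightarrow> letter list \<Rightarrow> letter list \<Rightarrow> nat set" where
  "cut_positions P k A B = (\<lambda>i. i mod length P) `
     {k, k + length A, k + length A + length B, k + length A + length B + length (hat A)}"

definition double_square :: "letter list \<Rightarrow> bool" where
  "double_square P \<longleftrightarrow> boundary_word P \<and>
     (\<exists>k A B l X Y. square_factorization P k A B \<and> square_factorization P l X Y \<and>
        cut_positions P k A B \<noteq> cut_positions P l X Y)"

definition homologous_morphism :: "(letter list \<Rightarrow> letter list) \<Rightarrow> bool" where
  "homologous_morphism \<phi> \<longleftrightarrow>
     \<phi> [] = [] \<and> (\<forall>u v. \<phi> (u @ v) = \<phi> u @ \<phi> v) \<and> (\<forall>u. \<phi> (hat u) = hat (\<phi> u))"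

text \<open>
  The permutations of the letters that commute with \<open>bar\<close> are the eight linear isometries of the
  lattice.
\<close>

definition same_boundary :: "letter list \<Rightarrow> letter list \<Rightarrow> bool" where
  "same_boundary U V \<longleftrightarrow>
     (\<exists>\<sigma>. bij \<sigma> \<and> (\<forall>a. \<sigma> (bar a) = bar (\<sigma> a)) \<and> circ_eq (map \<sigma> U) V)"

definition prime_double_square :: "letter list \<Rightarrow> bool" where
  "prime_double_square P \<longleftrightarrow> double_square P \<and>
     (\<forall>\<phi> U. homologous_morphism \<phi> \<and> boundary_word U \<and> circ_eq P (\<phi> U) \<longrightarrow>
        same_boundary U P \<or> same_boundary U simple_square)"

end

theory Submission
  imports Defs
begin

text \<open>
  A lattice polygon turns by \<open>\<plusminus>4\<close> quarter turns in total. Along \<open>A B (hat A) (hat B)\<close> the turns inside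
  \<open>A\<close> and \<open>hat A\<close>, and inside \<open>B\<close> and \<open>hat B\<close>, cancel, so all four corners are quarter turns in the same
  direction. Together with the absence of closed proper factors this forces the cuts of two distinct
  factorizations to alternate, and \<open>P = w\<^sub>1 \<dots> w\<^sub>8\<close> where \<open>hat (w\<^sub>i w\<^sub>i\<^sub>+\<^sub>1) = w\<^sub>i\<^sub>+\<^sub>4 w\<^sub>i\<^sub>+\<^sub>5\<close>.

  Such systems of words are reduced by a Euclidean algorithm: either remove a period of length
  \<open>|w\<^sub>i\<^sub>-\<^sub>1| + |w\<^sub>i\<^sub>+\<^sub>1|\<close> from \<open>w\<^sub>i\<close> and \<open>w\<^sub>i\<^sub>+\<^sub>4\<close>, or replace every second word by its complement in that
  period. It stops when two words become empty, and then everything is made of two words \<open>p\<close> and \<open>q\<close>.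
  Undoing the reductions gives \<open>P = \<phi>(U)\<close> with \<open>\<phi>(0) = p\<close>, \<open>\<phi>(1) = q\<close> and a boundary word \<open>U\<close> of length at
  least 8 whose letters are horizontal and vertical in turn. If \<open>P\<close> is prime, then it is an isometric
  copy of \<open>U\<close>, so equal letters are never adjacent.
\<close>

section \<open>Conjugate words and the equations of a double square\<close>

lemma bar_bar [simp]: "bar (bar x) = x"
  by (cases x) auto

lemma bar_neq [simp]: "bar x \<noteq> x" "x \<noteq> bar x"
  by (cases x; simp)+

lemma hat_Nil [simp]: "hat [] = []"
  and hat_append [simp]: "hat (u @ v) = hat v @ hat u"
  and hat_hat [simp]: "hat (hat w) = w"
  and length_hat [simp]: "length (hat w) = length w"
  and hat_eq_Nil_iff [simp]: "hat w = [] \<longleftrightarrow> w = []"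
  by (simp_all add: hat_def rev_map o_def)

lemma hat_eq_iff [simp]: "hat u = hat v \<longleftrightarrow> u = v"
  by (metis hat_hat)

lemma hd_hat: "w \<noteq> [] \<Longrightarrow> hd (hat w) = bar (last w)"
  and last_hat: "w \<noteq> [] \<Longrightarrow> last (hat w) = bar (hd w)"
  by (simp_all add: hat_def hd_rev last_rev last_map hd_map)

lemma append_eq_append_leD:
  assumes "xs @ ys = us @ vs" "length us \<le> length xs"
  obtains zs where "xs = us @ zs" "vs = zs @ ys"
  using assms by (auto simp: append_eq_append_conv2)

text \<open>
  The arguments are the consecutive blocks \<open>w\<^sub>1, \<dots>, w\<^sub>8\<close> of the circular word. Each equation states that
  the union of two adjacent blocks is homologous to the opposite one.
\<close>

definition conj_system ::
  "letter list \<Rightarrow> letter list \<Rightarrow> letter list \<Rightarrow> letter list \<Rightarrow>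
   letter list \<Rightarrow> letter list \<Rightarrow> letter list \<Rightarrow> letter list \<Rightarrow> bool" where
  "conj_system a b c d e f g h \<longleftrightarrow>
     a @ b = hat f @ hat e \<and> b @ c = hat g @ hat f \<and> c @ d = hat h @ hat g \<and> d @ e = hat a @ hat h"

lemma conj_system_rotate: "conj_system a b c d e f g h = conj_system b c d e f g h a"
proof -
  have "a @ b = hat f @ hat e \<longleftrightarrow> e @ f = hat b @ hat a"
    by (metis hat_append hat_hat)
  then show ?thesis
    unfolding conj_system_def by blast
qed

lemma conj_system_rotate2: "conj_system a b c d e f g h = conj_system c d e f g h a b"
  by (rule trans[OF conj_system_rotate conj_system_rotate])

lemma conj_system_rotate4: "conj_system a b c d e f g h = conj_system e f g h a b c d"
  by (rule trans[OF conj_system_rotate2 conj_system_rotate2])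

lemma conj_system_lengths:
  assumes "conj_system a b c d e f g h"
  shows "length e = length a" "length f = length b" "length g = length c" "length h = length d"
proof -
  have "length (a @ b) = length (hat f @ hat e)" "length (b @ c) = length (hat g @ hat f)"
    "length (c @ d) = length (hat h @ hat g)" "length (d @ e) = length (hat a @ hat h)"
    using assms unfolding conj_system_def by simp_all
  then show "length e = length a" "length f = length b" "length g = length c" "length h = length d"
    by simp_all
qed

text \<open>Both sides equal \<open>hat f @ hat e @ hat d\<close>. Hence \<open>a\<close> has the
  period |\<open>b\<close>| + |\<open>d\<close>|, with period word \<open>hat f @ h\<close> on the
  left and \<open>b @ hat d\<close> on the right. Both reductions rest on this.\<close>

lemma conj_system_period:
  assumes "conj_system a b c d e f g h"
  shows "hat f @ h @ a = a @ b @ hat d"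
proof -
  have "h @ a = hat e @ hat d"
    using assms unfolding conj_system_def by (metis hat_append hat_hat)
  then show ?thesis
    using assms unfolding conj_system_def by (metis append_assoc)
qed

text \<open>A block at least as long as its two neighbours together contains a full period, which
  can be taken off at either end. The same rest \<open>a'\<close> remains both times, and likewise
  \<open>e'\<close> in the opposite block.\<close>

lemma conj_system_shrink:
  assumes sys: "conj_system a b c d e f g h" and le: "length h + length b \<le> length a"
  obtains a' e' where "a = hat f @ h @ a'" "a = a' @ b @ hat d" "e = hat b @ d @ e'" "e = e' @ f @ hat h"
    "conj_system a' b c d e' f g h"
proof -
  note len = conj_system_lengths[OF sys]
  have sys4: "conj_system e f g h a b c d"
    using sys by (subst (asm) conj_system_rotate4)
  have pa: "hat f @ h @ a = a @ b @ hat d" and pe: "hat b @ d @ e = e @ f @ hat h"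
    using conj_system_period[OF sys] conj_system_period[OF sys4] by simp_all
  obtain a' where a: "a = hat f @ h @ a'" "a = a' @ b @ hat d"
    using append_eq_append_leD[of a "b @ hat d" "hat f @ h" a] pa le len by auto
  obtain e' where e: "e = hat b @ d @ e'" "e = e' @ f @ hat h"
    using append_eq_append_leD[of e "f @ hat h" "hat b @ d" e] pe le len by auto
  \<comment> \<open>The reversed words are expanded from the suffix forms and the plain words from
    the prefix forms, so the removed period words cancel in both equations.\<close>
  have ha: "hat a = d @ hat b @ hat a'" and he: "hat e = h @ hat f @ hat e'"
    by (subst a(2), simp) (subst e(2), simp)
  have "a @ b = hat f @ hat e" "d @ e = hat a @ hat h"
    using sys unfolding conj_system_def by simp_all
  then have "hat f @ h @ a' @ b = hat f @ h @ hat f @ hat e'" "d @ hat b @ d @ e' = d @ hat b @ hat a' @ hat h"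
    unfolding ha he using a(1) e(1) by simp_all
  then have "conj_system a' b c d e' f g h"
    using sys unfolding conj_system_def by simp
  with a e show thesis by (rule that)
qed

text \<open>Inverse to \<open>conj_system_shrink\<close>; it rebuilds solutions over letters when
  the reduction is undone.\<close>

lemma conj_system_expand:
  assumes "conj_system a b c d e f g h"
  shows "conj_system (hat f @ h @ a) b c d (hat b @ d @ e) f g h"
proof -
  have "h @ a = hat e @ hat d"
    using assms unfolding conj_system_def by (metis hat_append hat_hat)
  moreover have "hat a @ hat h @ f = d @ hat b @ hat a"
    using arg_cong[OF conj_system_period[OF assms], of hat] by simp
  ultimately show ?thesis
    using assms unfolding conj_system_def by (metis append_assoc hat_append hat_hat)
qed

text \<open>The period equation of \<open>b\<close> is
  \<open>(hat g @ a) @ b = b @ (c @ hat e)\<close>. A block no longer than its period is a prefix of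
  the left period word, and the same rest \<open>v\<close> precedes it in the right one.\<close>

lemma conj_system_complement:
  assumes "conj_system a b c d e f g h" and "length b \<le> length a + length c"
  obtains v where "b @ v = hat g @ a" "v @ b = c @ hat e"
proof -
  have "conj_system b c d e f g h a"
    using assms(1) by (subst (asm) conj_system_rotate)
  from conj_system_period[OF this] have "(hat g @ a) @ b = b @ c @ hat e"
    by simp
  moreover have "length b \<le> length (hat g @ a)"
    using assms(2) conj_system_lengths[OF assms(1)] by simp
  ultimately obtain v where "hat g @ a = b @ v" "c @ hat e = v @ b"
    by (rule append_eq_append_leD)
  then show thesis using that by simp
qed

lemma conj_system_swap:
  assumes "conj_system a b c d e f g h"
    and "b @ v1 = hat g @ a" "v1 @ b = c @ hat e" "d @ v3 = hat a @ c" "v3 @ d = e @ hat g"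
    and "f @ v5 = hat c @ e" "v5 @ f = g @ hat a" "h @ v7 = hat e @ g" "v7 @ h = a @ hat c"
  shows "conj_system (hat e) v1 (hat g) v3 (hat a) v5 (hat c) v7"
proof -
  \<comment> \<open>The equations for two opposite complements: after adding \<open>hat f\<close> on
    one side both expressions can be computed, and \<open>hat f\<close> cancels. Shifted by two
    blocks, the statement gives the other two equations.\<close>
  have *: "hat e @ v1 = hat v5 @ a \<and> v1 @ hat g = c @ hat v5"
    if "conj_system a b c d e f g h" "b @ v1 = hat g @ a" "v1 @ b = c @ hat e"
      "f @ v5 = hat c @ e" "v5 @ f = g @ hat a"
    for a b c d e f g h v1 v5
  proof
    have "hat f @ hat v5 = a @ hat g" "hat v5 @ hat f = hat e @ c"
      using arg_cong[OF that(4), of hat] arg_cong[OF that(5), of hat] by simp_all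
    note hv = this
    have "hat f @ hat e @ v1 = a @ b @ v1"
      using that(1) unfolding conj_system_def by simp
    also have "\<dots> = hat f @ hat v5 @ a"
      using that(2) hv(1) by (metis append_assoc)
    finally show "hat e @ v1 = hat v5 @ a" by simp
    have "v1 @ hat g @ hat f = v1 @ b @ c"
      using that(1) unfolding conj_system_def by simp
    also have "\<dots> = c @ hat v5 @ hat f"
      using that(3) hv(2) by (metis append_assoc)
    finally have "(v1 @ hat g) @ hat f = (c @ hat v5) @ hat f" by simp
    then show "v1 @ hat g = c @ hat v5" by simp
  qed
  have "conj_system c d e f g h a b"
    using assms(1) by (subst (asm) conj_system_rotate2)
  from *[OF assms(1-3,6,7)] *[OF this assms(4,5,8,9)] show ?thesis
    unfolding conj_system_def by simp
qed

text \<open>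
  Here \<open>r\<close> will be the rotation by a quarter turn in the direction in which the boundary is traversed.
\<close>

definition convex_corners ::
  "(letter \<Rightarrow> letter) \<Rightarrow> letter list \<Rightarrow> letter list \<Rightarrow> letter list \<Rightarrow> letter list \<Rightarrow>
   letter list \<Rightarrow> letter list \<Rightarrow> letter list \<Rightarrow> letter list \<Rightarrow> bool" where
  "convex_corners r a b c d e f g h \<longleftrightarrow> (\<forall>w \<in> {a, b, c, d, e, f, g, h}. w \<noteq> []) \<and>
     hd b = r (last a) \<and> hd c = r (last b) \<and> hd d = r (last c) \<and> hd e = r (last d) \<and>
     hd f = r (last e) \<and> hd g = r (last f) \<and> hd h = r (last g) \<and> hd a = r (last h)"

lemma convex_corners_rotate: "convex_corners r a b c d e f g h = convex_corners r b c d e f g h a"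
  unfolding convex_corners_def by auto

lemma convex_corners_rotate2: "convex_corners r a b c d e f g h = convex_corners r c d e f g h a b"
  by (rule trans[OF convex_corners_rotate convex_corners_rotate])

lemma convex_corners_rotate4: "convex_corners r a b c d e f g h = convex_corners r e f g h a b c d"
  by (rule trans[OF convex_corners_rotate2 convex_corners_rotate2])

lemma hd_last_of_append_hat_eq:
  assumes "a @ b = hat f @ hat e" "a \<noteq> []" "b \<noteq> []" "e \<noteq> []" "f \<noteq> []"
  shows "hd a = bar (last f)" "last b = bar (hd e)"
  using arg_cong[OF assms(1), of hd] arg_cong[OF assms(1), of last] assms(2-)
  by (simp_all add: hd_hat last_hat)

lemma convex_corners_hd:
  assumes "conj_system a b c d e f g h" "convex_corners r a b c d e f g h"
  shows "hd c = r (bar (hd e))"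
  using assms hd_last_of_append_hat_eq(2)[of a b f e]
  unfolding conj_system_def convex_corners_def by simp

lemma convex_corners_last:
  assumes "conj_system a b c d e f g h" "convex_corners r a b c d e f g h"
  shows "bar (last g) = r (last a)"
  using assms hd_last_of_append_hat_eq(1)[of b c g f]
  unfolding conj_system_def convex_corners_def by simp

lemma quarter_turn_bar: "(\<And>x. r (r x) = bar x) \<Longrightarrow> r (bar x) = bar (r x)"
  by metis

text \<open>Two uses of \<open>convex_corners_hd\<close> apply \<open>r\<close> twice and
  \<open>bar\<close> twice, and \<open>r\<close> twice is \<open>bar\<close>.\<close>

lemma convex_corners_opposite_hd:
  assumes r: "\<And>x. r (r x) = bar x"
    and "conj_system a b c d e f g h" "convex_corners r a b c d e f g h"
  shows "hd c = bar (hd g)"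
proof -
  have "conj_system c d e f g h a b" "convex_corners r c d e f g h a b"
    using assms(2,3) by (subst (asm) conj_system_rotate2, simp, subst (asm) convex_corners_rotate2, simp)
  from convex_corners_hd[OF this] convex_corners_hd[OF assms(2,3)] show ?thesis
    using r quarter_turn_bar[OF r] by simp
qed

text \<open>\<open>a'\<close> is both a prefix and a suffix of \<open>a\<close>, so no letter at a
  corner changes; the same holds for \<open>e'\<close>.\<close>

lemma convex_corners_shrink:
  assumes "convex_corners r a b c d e f g h"
    and "a = hat f @ h @ a'" "a = a' @ b @ hat d" "e = hat b @ d @ e'" "e = e' @ f @ hat h"
    and "a' \<noteq> []" "e' \<noteq> []"
  shows "convex_corners r a' b c d e' f g h"
proof -
  have "hd a = hd a'" "hd e = hd e'"
    using assms(6,7) by (subst assms(3), simp, subst assms(5), simp)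
  moreover have "last a = last a'" "last e = last e'"
    using assms(6,7) by (subst assms(2), simp, subst assms(4), simp)
  ultimately show ?thesis
    using assms(1,6,7) unfolding convex_corners_def by simp
qed

text \<open>A complement begins like the block after and ends like the block before:
  \<open>v1\<close> begins as \<open>c\<close> and ends as \<open>a\<close>. The new corners thus
  reduce to relations between corner letters of the old system.\<close>

lemma convex_corners_swap:
  assumes r: "\<And>x. r (r x) = bar x"
    and sys: "conj_system a b c d e f g h" and cv: "convex_corners r a b c d e f g h"
    and v1: "b @ v1 = hat g @ a" "v1 @ b = c @ hat e" and v3: "d @ v3 = hat a @ c" "v3 @ d = e @ hat g"
    and v5: "f @ v5 = hat c @ e" "v5 @ f = g @ hat a" and v7: "h @ v7 = hat e @ g" "v7 @ h = a @ hat c"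
    and "v1 \<noteq> []" "v3 \<noteq> []" "v5 \<noteq> []" "v7 \<noteq> []"
  shows "convex_corners r (hat e) v1 (hat g) v3 (hat a) v5 (hat c) v7"
proof -
  note sys2 = sys[unfolded conj_system_rotate2[of a]] sys[unfolded conj_system_rotate4[of a]]
    sys[unfolded conj_system_rotate4[of a] conj_system_rotate2[of e]]
  note cv2 = cv[unfolded convex_corners_rotate2[of r a]] cv[unfolded convex_corners_rotate4[of r a]]
    cv[unfolded convex_corners_rotate4[of r a] convex_corners_rotate2[of r e]]
  have ne: "a \<noteq> []" "c \<noteq> []" "e \<noteq> []" "g \<noteq> []"
    using cv unfolding convex_corners_def by simp_all
  have "hd v1 = hd c" "hd v3 = hd e" "hd v5 = hd g" "hd v7 = hd a"
    using ne assms(12-) arg_cong[OF v1(2), of hd] arg_cong[OF v3(2), of hd]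
      arg_cong[OF v5(2), of hd] arg_cong[OF v7(2), of hd] by simp_all
  moreover have "last v1 = last a" "last v3 = last c" "last v5 = last e" "last v7 = last g"
    using ne assms(12-) arg_cong[OF v1(1), of last] arg_cong[OF v3(1), of last]
      arg_cong[OF v5(1), of last] arg_cong[OF v7(1), of last] by simp_all
  ultimately have
    "hd v1 = r (bar (hd e))" "hd v3 = r (bar (hd g))" "hd v5 = r (bar (hd a))" "hd v7 = r (bar (hd c))"
    "bar (last g) = r (last v1)" "bar (last a) = r (last v3)"
    "bar (last c) = r (last v5)" "bar (last e) = r (last v7)"
    using convex_corners_hd[OF sys cv] convex_corners_hd[OF sys2(1) cv2(1)]
      convex_corners_hd[OF sys2(2) cv2(2)] convex_corners_hd[OF sys2(3) cv2(3)]
      convex_corners_last[OF sys cv] convex_corners_last[OF sys2(1) cv2(1)]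
      convex_corners_last[OF sys2(2) cv2(2)] convex_corners_last[OF sys2(3) cv2(3)]
    by argo+
  then show ?thesis
    using ne assms(12-) unfolding convex_corners_def by (simp add: hd_hat last_hat)
qed

text \<open>
  The case in which neither reduction shortens the words. It contradicts
  \<open>convex_corners_opposite_hd\<close>.
\<close>

lemma conj_system_balanced_lengths_eq:
  assumes sys: "conj_system a b c d e f g h"
    and len: "length a + length c = length b + length d" "length c \<le> length b" "length c \<le> length d"
  shows "c = g"
proof -
  note ls = conj_system_lengths[OF sys]
  have eqs: "a @ b = hat f @ hat e" "b @ c = hat g @ hat f" "c @ d = hat h @ hat g"
    using sys unfolding conj_system_def by simp_all
  have ha: "h @ a = hat e @ hat d"
    using sys unfolding conj_system_def by (metis hat_append hat_hat)
  obtain y where y: "b = hat g @ y" "hat f = y @ c"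
    using append_eq_append_leD[OF eqs(2)] len ls by auto
  obtain x where x: "hat h = c @ x" "d = x @ hat g"
    using append_eq_append_leD[OF eqs(3)[symmetric]] len ls by auto
  have la: "length a = length y + length c + length x"
    using arg_cong[OF y(1), of length] arg_cong[OF x(2), of length] len ls by simp
  obtain s where s: "a = (y @ c) @ s" "hat e = s @ b"
    using append_eq_append_leD[OF eqs(1)[unfolded y(2)]] la by auto
  have h: "h = hat x @ hat c" and d: "hat d = g @ hat x"
    using arg_cong[OF x(1), of hat] x(2) by simp_all
  \<comment> \<open>Both sides open with words of equal length, \<open>hat x\<close> and
    \<open>s\<close>. Once these are cancelled, \<open>hat c\<close> and \<open>hat g\<close> face
    each other.\<close>
  have "hat x @ hat c @ y @ c @ s = s @ hat g @ y @ g @ hat x"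
    using ha unfolding h d s y(1) by simp
  moreover have "length s = length (hat x)"
    using arg_cong[OF s(1), of length] la by simp
  ultimately have "hat c @ y @ c @ s = hat g @ y @ g @ hat x"
    by simp
  then have "hat c = hat g"
    using ls by simp
  then show ?thesis by simp
qed

section \<open>Alternating words and substitutions for their letters\<close>

fun horizontal :: "letter \<Rightarrow> bool" where
  "horizontal East = True"
| "horizontal North = False"
| "horizontal West = True"
| "horizontal South = False"

lemma horizontal_bar [simp]: "horizontal (bar x) = horizontal x"
  by (cases x) auto

fun alternating :: "bool \<Rightarrow> letter list \<Rightarrow> bool" where
  "alternating s [] = True"
| "alternating s (x # xs) = (horizontal x = s \<and> alternating (\<not> s) xs)"

lemma alternating_append [simp]:
  "alternating s (u @ v) \<longleftrightarrow> alternating s u \<and> alternating (s = even (length u)) v"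
proof (induction u arbitrary: s)
  case (Cons x u)
  then show ?case
    by (cases s; cases "even (length u)") simp_all
qed simp

lemma alternating_hat [simp]: "alternating s (hat w) \<longleftrightarrow> alternating (s = odd (length w)) w"
proof (induction w arbitrary: s)
  case (Cons x w)
  have "hat (x # w) = hat w @ [bar x]" by (simp add: hat_def)
  then show ?case
    using Cons by (cases s; cases "even (length w)") auto
qed simp

definition letter_image :: "letter list \<Rightarrow> letter list \<Rightarrow> letter \<Rightarrow> letter list" where
  "letter_image p q x = (case x of East \<Rightarrow> p | North \<Rightarrow> q | West \<Rightarrow> hat p | South \<Rightarrow> hat q)"

definition letter_subst :: "letter list \<Rightarrow> letter list \<Rightarrow> letter list \<Rightarrow> letter list" where
  "letter_subst p q w = concat (map (letter_image p q) w)"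

lemma letter_subst_Nil [simp]: "letter_subst p q [] = []"
  and letter_subst_Cons [simp]: "letter_subst p q (x # w) = letter_image p q x @ letter_subst p q w"
  and letter_subst_append [simp]: "letter_subst p q (u @ v) = letter_subst p q u @ letter_subst p q v"
  by (simp_all add: letter_subst_def)

lemma letter_subst_hat [simp]: "letter_subst p q (hat w) = hat (letter_subst p q w)"
proof (induction w)
  case (Cons x w)
  have "hat (x # w) = hat w @ [bar x]" by (simp add: hat_def)
  moreover have "letter_image p q (bar x) = hat (letter_image p q x)"
    by (cases x) (simp_all add: letter_image_def)
  ultimately show ?case using Cons by simp
qed simp

text \<open>Adjacent blocks have lengths of opposite parity. This keeps the word alternating when
  reversed blocks are inserted or blocks are replaced by complements.\<close>

definition alternating_solution ::
  "letter list \<Rightarrow> letter list \<Rightarrow> letter list \<Rightarrow> letter list \<Rightarrow>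
   letter list \<Rightarrow> letter list \<Rightarrow> letter list \<Rightarrow> letter list \<Rightarrow> bool" where
  "alternating_solution a b c d e f g h \<longleftrightarrow> conj_system a b c d e f g h \<and>
     (\<exists>s. alternating s (a @ b @ c @ d @ e @ f @ g @ h)) \<and>
     odd (length a + length b) \<and> odd (length b + length c) \<and> odd (length c + length d)"

text \<open>\<open>p\<close> and \<open>q\<close> replace \<open>East\<close> and
  \<open>North\<close>. As both are nonempty the substitution erases nothing, so proper factors stay
  proper.\<close>

inductive alternating_image ::
  "letter list \<Rightarrow> letter list \<Rightarrow> letter list \<Rightarrow> letter list \<Rightarrow>
   letter list \<Rightarrow> letter list \<Rightarrow> letter list \<Rightarrow> letter list \<Rightarrow> bool" where
  alternating_imageI: "alternating_solution a b c d e f g h \<Longrightarrow> p \<noteq> [] \<Longrightarrow> q \<noteq> [] \<Longrightarrow>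
    alternating_image (letter_subst p q a) (letter_subst p q b) (letter_subst p q c) (letter_subst p q d)
      (letter_subst p q e) (letter_subst p q f) (letter_subst p q g) (letter_subst p q h)"

lemma alternating_solution_rotate:
  assumes "alternating_solution a b c d e f g h"
  shows "alternating_solution b c d e f g h a"
proof -
  have sys: "conj_system a b c d e f g h"
    and odd: "odd (length a + length b)" "odd (length b + length c)" "odd (length c + length d)"
    using assms unfolding alternating_solution_def by simp_all
  note len = conj_system_lengths[OF sys]
  obtain s where "alternating s (a @ b @ c @ d @ e @ f @ g @ h)"
    using assms unfolding alternating_solution_def by blast
  then have "alternating (s = even (length a)) (b @ c @ d @ e @ f @ g @ h @ a)"
    using odd len by (cases "even (length a)"; cases "even (length b)"; cases s) simp_all
  moreover have "conj_system b c d e f g h a"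
    using sys by (subst (asm) conj_system_rotate)
  moreover have "odd (length d + length e)"
    using odd len by presburger
  ultimately show ?thesis
    using odd unfolding alternating_solution_def by blast
qed

lemma alternating_image_rotate_imp:
  assumes "alternating_image a b c d e f g h"
  shows "alternating_image b c d e f g h a"
  using assms by cases (auto intro: alternating_imageI alternating_solution_rotate)

lemma alternating_image_rotate:
  "alternating_image a b c d e f g h = alternating_image b c d e f g h a"
proof
  assume "alternating_image b c d e f g h a"
  then have "alternating_image c d e f g h a b" by (rule alternating_image_rotate_imp)
  then have "alternating_image d e f g h a b c" by (rule alternating_image_rotate_imp)
  then have "alternating_image e f g h a b c d" by (rule alternating_image_rotate_imp)
  then have "alternating_image f g h a b c d e" by (rule alternating_image_rotate_imp)
  then have "alternating_image g h a b c d e f" by (rule alternating_image_rotate_imp)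
  then have "alternating_image h a b c d e f g" by (rule alternating_image_rotate_imp)
  then show "alternating_image a b c d e f g h" by (rule alternating_image_rotate_imp)
qed (rule alternating_image_rotate_imp)

lemma alternating_solution_expand:
  assumes "alternating_solution a b c d e f g h"
  shows "alternating_solution (hat f @ h @ a) b c d (hat b @ d @ e) f g h"
proof -
  have sys: "conj_system a b c d e f g h"
    and odd: "odd (length a + length b)" "odd (length b + length c)" "odd (length c + length d)"
    using assms unfolding alternating_solution_def by simp_all
  note len = conj_system_lengths[OF sys]
  obtain s where "alternating s (a @ b @ c @ d @ e @ f @ g @ h)"
    using assms unfolding alternating_solution_def by blast
  then have "alternating s ((hat f @ h @ a) @ b @ c @ d @ (hat b @ d @ e) @ f @ g @ h)"
    using odd len by (cases "even (length a)"; cases "even (length b)"; cases s) simp_all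
  moreover have "odd (length (hat f @ h @ a) + length b)"
    using odd len by simp
  ultimately show ?thesis
    using odd conj_system_expand[OF sys] unfolding alternating_solution_def by blast
qed

lemma alternating_image_expand:
  assumes "alternating_image a b c d e f g h"
  shows "alternating_image (hat f @ h @ a) b c d (hat b @ d @ e) f g h"
  using assms
proof cases
  case (alternating_imageI a' b' c' d' e' f' g' h' p q)
  with alternating_image.alternating_imageI[OF alternating_solution_expand, of a' b' c' d' e' f' g' h' p q]
  show ?thesis by simp
qed

lemma alternating_solution_swap:
  assumes "alternating_solution a b c d e f g h"
    and v1: "b @ v1 = hat g @ a" "v1 @ b = c @ hat e" and v3: "d @ v3 = hat a @ c" "v3 @ d = e @ hat g"
    and v5: "f @ v5 = hat c @ e" "v5 @ f = g @ hat a" and v7: "h @ v7 = hat e @ g" "v7 @ h = a @ hat c"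
  shows "alternating_solution (hat e) v1 (hat g) v3 (hat a) v5 (hat c) v7"
proof -
  have sys: "conj_system a b c d e f g h"
    and odd: "odd (length a + length b)" "odd (length b + length c)" "odd (length c + length d)"
    using assms unfolding alternating_solution_def by simp_all
  note len = conj_system_lengths[OF sys]
  have "length b + length v1 = length g + length a" "length d + length v3 = length a + length c"
    "length f + length v5 = length c + length e" "length h + length v7 = length e + length g"
    using arg_cong[OF v1(1), of length] arg_cong[OF v3(1), of length]
      arg_cong[OF v5(1), of length] arg_cong[OF v7(1), of length] by simp_all
  then have lv: "even (length v1) = even (length b)" "even (length v3) = even (length b)"
    "even (length v5) = even (length b)" "even (length v7) = even (length b)"
    using odd len by presburger+
  obtain s where s: "alternating s (a @ b @ c @ d @ e @ f @ g @ h)"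
    using assms unfolding alternating_solution_def by blast
  have alt: "alternating t (b @ v1) = alternating t (hat g @ a)" "alternating t (d @ v3) = alternating t (hat a @ c)"
    "alternating t (f @ v5) = alternating t (hat c @ e)" "alternating t (h @ v7) = alternating t (hat e @ g)" for t
    using v1 v3 v5 v7 by simp_all
  have "alternating s (hat e @ v1 @ hat g @ v3 @ hat a @ v5 @ hat c @ v7) \<or>
    alternating (\<not> s) (hat e @ v1 @ hat g @ v3 @ hat a @ v5 @ hat c @ v7)"
    using s odd len lv alt[of True] alt[of False]
    by (cases "even (length a)"; cases "even (length b)"; cases s) simp_all
  moreover have "odd (length (hat e) + length v1)" "odd (length v1 + length (hat g))"
    "odd (length (hat g) + length v3)"
    using odd len lv by simp_all
  ultimately show ?thesis
    using conj_system_swap[OF sys assms(2-)] unfolding alternating_solution_def by blast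
qed

text \<open>A complement formed on words must come from one formed on letters. If \<open>b'\<close>
  did not fit into the period word \<open>hat g' @ a'\<close>, its image would be at least as long
  as \<open>hat g @ a\<close>, against \<open>v \<noteq> []\<close>.\<close>

lemma alternating_image_complement:
  assumes sol: "alternating_solution a' b' c' d' e' f' g' h'"
    and v: "b @ v = hat g @ a" "v @ b = c @ hat e"
    and im: "a = letter_subst p q a'" "b = letter_subst p q b'" "c = letter_subst p q c'" "e = letter_subst p q e'" "g = letter_subst p q g'"
    and "v \<noteq> []"
  obtains v' where "b' @ v' = hat g' @ a'" "v' @ b' = c' @ hat e'" "v = letter_subst p q v'"
proof -
  have sys: "conj_system a' b' c' d' e' f' g' h'"
    using sol unfolding alternating_solution_def by simp
  note len = conj_system_lengths[OF sys]
  have "conj_system b' c' d' e' f' g' h' a'"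
    using sys by (subst (asm) conj_system_rotate)
  from conj_system_period[OF this] have eq: "b' @ c' @ hat e' = (hat g' @ a') @ b'"
    by simp
  have "length b' \<le> length (hat g' @ a')"
  proof (rule ccontr)
    assume "\<not> ?thesis"
    then obtain x where "b' = (hat g' @ a') @ x"
      using append_eq_append_leD[OF eq] by auto
    then have "b = hat g @ a @ letter_subst p q x"
      using im by simp
    with v(1) \<open>v \<noteq> []\<close> show False
      using arg_cong[OF v(1), of length] by simp
  qed
  then obtain v' where v': "hat g' @ a' = b' @ v'" "c' @ hat e' = v' @ b'"
    using append_eq_append_leD[OF eq[symmetric]] by metis
  have "b @ v = letter_subst p q (b' @ v')"
    by (simp only: v(1) v'(1)[symmetric]) (simp add: im)
  then have "v = letter_subst p q v'"
    using im by simp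
  with v' that show thesis by simp
qed

lemma alternating_image_swap:
  assumes "alternating_image a b c d e f g h"
    and v1: "b @ v1 = hat g @ a" "v1 @ b = c @ hat e" and v3: "d @ v3 = hat a @ c" "v3 @ d = e @ hat g"
    and v5: "f @ v5 = hat c @ e" "v5 @ f = g @ hat a" and v7: "h @ v7 = hat e @ g" "v7 @ h = a @ hat c"
    and ne: "v1 \<noteq> []" "v3 \<noteq> []" "v5 \<noteq> []" "v7 \<noteq> []"
  shows "alternating_image (hat e) v1 (hat g) v3 (hat a) v5 (hat c) v7"
  using assms(1)
proof cases
  case (alternating_imageI a' b' c' d' e' f' g' h' p q)
  note im = this(1-8) and sol = this(9) and pq = this(10,11)
  have sol2: "alternating_solution c' d' e' f' g' h' a' b'"
    using sol by (rule alternating_solution_rotate[OF alternating_solution_rotate])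
  then have sol4: "alternating_solution e' f' g' h' a' b' c' d'"
    by (rule alternating_solution_rotate[OF alternating_solution_rotate])
  then have sol6: "alternating_solution g' h' a' b' c' d' e' f'"
    by (rule alternating_solution_rotate[OF alternating_solution_rotate])
  obtain v1' where v1': "b' @ v1' = hat g' @ a'" "v1' @ b' = c' @ hat e'" "v1 = letter_subst p q v1'"
    using alternating_image_complement[OF sol v1 im(1,2,3,5,7) ne(1)] .
  obtain v3' where v3': "d' @ v3' = hat a' @ c'" "v3' @ d' = e' @ hat g'" "v3 = letter_subst p q v3'"
    using alternating_image_complement[OF sol2 v3 im(3,4,5,7,1) ne(2)] .
  obtain v5' where v5': "f' @ v5' = hat c' @ e'" "v5' @ f' = g' @ hat a'" "v5 = letter_subst p q v5'"
    using alternating_image_complement[OF sol4 v5 im(5,6,7,1,3) ne(3)] .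
  obtain v7' where v7': "h' @ v7' = hat e' @ g'" "v7' @ h' = a' @ hat c'" "v7 = letter_subst p q v7'"
    using alternating_image_complement[OF sol6 v7 im(7,8,1,3,5) ne(4)] .
  have "alternating_solution (hat e') v1' (hat g') v3' (hat a') v5' (hat c') v7'"
    by (rule alternating_solution_swap[OF sol v1'(1,2) v3'(1,2) v5'(1,2) v7'(1,2)])
  from alternating_image.alternating_imageI[OF this pq] show ?thesis
    using im v1'(3) v3'(3) v5'(3) v7'(3) by simp
qed

section \<open>Reduction to two words\<close>

abbreviation list_power :: "'a list \<Rightarrow> nat \<Rightarrow> 'a list" where
  "list_power w n \<equiv> concat (replicate n w)"

lemma list_power_add: "list_power w (m + n) = list_power w m @ list_power w n"
  by (simp add: replicate_add)

lemma list_power_commute: "list_power w m @ list_power w n = list_power w n @ list_power w m"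
  by (metis add.commute list_power_add)

lemma list_power_slide: "u @ list_power (v @ u) n = list_power (u @ v) n @ u"
  by (induction n) simp_all

lemma length_list_power [simp]: "length (list_power w n) = n * length w"
  by (induction n) simp_all

lemma letter_subst_list_power [simp]: "letter_subst p q (list_power w n) = list_power (letter_subst p q w) n"
  by (induction n) simp_all

lemma alternating_list_power: "alternating s w \<Longrightarrow> even (length w) \<Longrightarrow> alternating s (list_power w n)"
  by (induction n) simp_all

lemma list_power_split:
  assumes "b @ d = list_power t l" "d \<noteq> []" "t \<noteq> []"
  obtains u v i j where "t = u @ v" "b = list_power t i @ u" "d = v @ list_power t j"
  using assms
proof (induction l arbitrary: b thesis)
  case (Suc l)
  have eq: "b @ d = t @ list_power t l" using Suc.prems(2) by simp
  show ?case
  proof (cases "length t \<le> length b")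
    case True
    then obtain b' where b': "b = t @ b'" "list_power t l = b' @ d"
      using append_eq_append_leD[OF eq] by auto
    obtain u v i j where "t = u @ v" "b' = list_power t i @ u" "d = v @ list_power t j"
      using Suc.IH[OF _ b'(2)[symmetric] Suc.prems(3,4)] by blast
    with b'(1) Suc.prems(1)[of u v "Suc i" j] show ?thesis by simp
  next
    case False
    then obtain v where "t = b @ v" "d = v @ list_power t l"
      using append_eq_append_leD[OF eq[symmetric]] by auto
    with Suc.prems(1)[of b v 0 l] show ?thesis by simp
  qed
qed simp

text \<open>With two opposite blocks empty, \<open>hat g\<close> commutes with \<open>b @ d\<close>,
  so both are powers of a common word \<open>t\<close>. The boundary between \<open>b\<close> and
  \<open>d\<close> cuts one copy of \<open>t\<close> into \<open>u @ v\<close>, and all blocks are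
  made of \<open>u\<close>, \<open>v\<close> and their hats.\<close>

lemma alternating_image_degenerate:
  assumes sys: "conj_system [] b c d [] f g h"
    and ne: "b \<noteq> []" "c \<noteq> []" "d \<noteq> []" and hd: "hd b \<noteq> hd d"
  shows "alternating_image [] b c d [] f g h"
proof -
  have b: "b = hat f" and bc: "b @ c = hat g @ b" and cd: "c @ d = d @ hat g" and d: "d = hat h"
    using sys unfolding conj_system_def by auto
  have "hat g @ (b @ d) = b @ (c @ d)"
    by (simp only: append_assoc[symmetric] bc)
  also have "\<dots> = (b @ d) @ hat g"
    by (simp only: append_assoc cd)
  finally have "hat g @ (b @ d) = (b @ d) @ hat g" .
  then obtain m l t where t: "list_power t m = hat g" "list_power t l = b @ d"
    using comm_append_are_replicate by metis
  have "t \<noteq> []" using t(2) ne by auto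
  then obtain u v i j where uv: "t = u @ v" "b = list_power t i @ u" "d = v @ list_power t j"
    using list_power_split[OF t(2)[symmetric] ne(3)] by metis
  have "list_power t i @ u @ c = list_power t m @ list_power t i @ u"
    using bc uv(2) t(1) by simp
  also have "\<dots> = list_power t i @ list_power t m @ u"
    by (simp only: append_assoc[symmetric] list_power_commute)
  finally have "u @ c = u @ list_power (v @ u) m"
    unfolding uv(1) list_power_slide by simp
  then have c: "c = list_power (v @ u) m" by simp
  have hd_pow: "w \<noteq> [] \<Longrightarrow> list_power w n \<noteq> [] \<Longrightarrow> hd (list_power w n) = hd w" for w :: "letter list" and n
    by (cases n) auto
  \<comment> \<open>With an empty part, \<open>b\<close> and \<open>d\<close> would both begin with
    the first letter of \<open>t\<close>.\<close>
  have "hd b = hd d" if "u = [] \<or> v = []"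
  proof (cases "u = []")
    case True
    then show ?thesis
      using uv ne \<open>t \<noteq> []\<close> hd_pow[of t i] by simp
  next
    case False
    with that have v: "v = []" by simp
    then have "hd b = hd t"
      using uv \<open>t \<noteq> []\<close> by (cases i) auto
    with v show ?thesis
      using uv ne \<open>t \<noteq> []\<close> hd_pow[of t j] by simp
  qed
  with hd have "u \<noteq> []" "v \<noteq> []" by auto
  define EN NE where "EN = [East, North]" and "NE = [North, East]"
  \<comment> \<open>\<open>East\<close> stands for \<open>u\<close> and \<open>North\<close> for
    \<open>v\<close>, so that \<open>EN\<close> is mapped to \<open>t\<close> and the three words to
    \<open>b\<close>, \<open>c\<close> and \<open>d\<close>.\<close>
  define b' c' d' where "b' = list_power EN i @ [East]" and "c' = list_power NE m"
    and "d' = North # list_power EN j"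
  have E: "East # list_power NE n = list_power EN n @ [East]" for n
    using list_power_slide[where u = "[East]" and v = "[North]"] by (simp add: EN_def NE_def)
  have N: "list_power NE n @ [North] = North # list_power EN n" for n
    using list_power_slide[where u = "[North]" and v = "[East]"] by (simp add: EN_def NE_def)
  have "b' @ c' = list_power EN i @ list_power EN m @ [East]"
    by (simp add: b'_def c'_def E)
  also have "\<dots> = list_power EN m @ b'"
    by (simp only: b'_def append_assoc[symmetric] list_power_commute)
  finally have bc': "b' @ c' = list_power EN m @ b'" .
  have "c' @ d' = (list_power NE m @ [North]) @ list_power EN j"
    by (simp add: c'_def d'_def)
  also have "\<dots> = d' @ list_power EN m"
    unfolding N d'_def by (simp add: list_power_commute)
  finally have cd': "c' @ d' = d' @ list_power EN m" .
  have "conj_system [] b' c' d' [] (hat b') (hat (list_power EN m)) (hat d')"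
    unfolding conj_system_def using bc' cd' by simp
  moreover have "alternating True (list_power EN n)" "alternating False (list_power NE n)" for n
    by (auto intro!: alternating_list_power simp: EN_def NE_def)
  moreover have "even (length (list_power EN n))" "even (length (list_power NE n))" for n
    by (simp_all add: EN_def NE_def)
  ultimately have "alternating_solution [] b' c' d' [] (hat b') (hat (list_power EN m)) (hat d')"
    unfolding alternating_solution_def b'_def c'_def d'_def by (auto intro!: exI[of _ True])
  from alternating_imageI[OF this \<open>u \<noteq> []\<close> \<open>v \<noteq> []\<close>]
  have "alternating_image [] (letter_subst u v b') (letter_subst u v c') (letter_subst u v d') []
    (hat (letter_subst u v b')) (hat (list_power t m)) (hat (letter_subst u v d'))"
    by (simp add: EN_def letter_image_def uv(1))
  moreover have "letter_subst u v b' = b" "letter_subst u v c' = c" "letter_subst u v d' = d"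
    unfolding b'_def c'_def d'_def EN_def NE_def c uv(2,3) by (simp_all add: letter_image_def uv(1))
  ultimately show ?thesis
    using b d t(1) by simp
qed

section \<open>The Euclidean algorithm on block lengths\<close>

lemma alternating_image_of_long_block:
  assumes r: "\<And>x. r (r x) = bar x"
    and sys: "conj_system a b c d e f g h" and cv: "convex_corners r a b c d e f g h"
    and le: "length h + length b \<le> length a"
    and IH: "\<And>a' e'. conj_system a' b c d e' f g h \<Longrightarrow> convex_corners r a' b c d e' f g h \<Longrightarrow>
      length a' < length a \<Longrightarrow> alternating_image a' b c d e' f g h"
  shows "alternating_image a b c d e f g h"
proof -
  obtain a' e' where a: "a = hat f @ h @ a'" "a = a' @ b @ hat d" and e: "e = hat b @ d @ e'" "e = e' @ f @ hat h"
    and sys': "conj_system a' b c d e' f g h"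
    by (rule conj_system_shrink[OF sys le])
  have ne: "b \<noteq> []" "c \<noteq> []" "d \<noteq> []"
    using cv unfolding convex_corners_def by simp_all
  have "alternating_image a' b c d e' f g h"
  proof (cases "a' = []")
    case True
    then have "e' = []"
      using conj_system_lengths(1)[OF sys'] by simp
    \<comment> \<open>Convex corners make sense for nonempty blocks only, so the inequality needed
      in the degenerate case is read off the system before the period is removed.\<close>
    have "conj_system h a b c d e f g" "convex_corners r h a b c d e f g"
      using sys cv conj_system_rotate[of h] convex_corners_rotate[of r h] by simp_all
    from convex_corners_hd[OF this] have "hd b = r (bar (hd d))" .
    then have "hd b \<noteq> hd d"
      using r by (metis bar_bar bar_neq(1))
    then show ?thesis
      using alternating_image_degenerate ne sys' \<open>a' = []\<close> \<open>e' = []\<close> by simp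
  next
    case False
    then have "e' \<noteq> []"
      using conj_system_lengths(1)[OF sys'] by auto
    have "length a' < length a"
      using ne arg_cong[OF a(2), of length] by simp
    then show ?thesis
      using IH[OF sys' convex_corners_shrink[OF cv a e False \<open>e' \<noteq> []\<close>]] by simp
  qed
  from alternating_image_expand[OF this] show ?thesis
    using a(1) e(1) by simp
qed

text \<open>The complements have lengths |\<open>a\<close>| + |\<open>c\<close>| -
  |\<open>b\<close>| and |\<open>a\<close>| + |\<open>c\<close>| - |\<open>d\<close>|, so putting
  them in place of \<open>b\<close>, \<open>d\<close>, \<open>f\<close>, \<open>h\<close> shortens
  the system exactly when |\<open>a\<close>| + |\<open>c\<close>| < |\<open>b\<close>| +
  |\<open>d\<close>|.\<close>

lemma alternating_image_of_short_blocks: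
  assumes r: "\<And>x. r (r x) = bar x"
    and sys: "conj_system a b c d e f g h" and cv: "convex_corners r a b c d e f g h"
    and short: "length b < length a + length c" "length d < length a + length c"
    and less: "length a + length c < length b + length d"
    and IH: "\<And>a' b' c' d' e' f' g' h'. conj_system a' b' c' d' e' f' g' h' \<Longrightarrow>
      convex_corners r a' b' c' d' e' f' g' h' \<Longrightarrow>
      length a' + length b' + length c' + length d' < length a + length b + length c + length d \<Longrightarrow>
      alternating_image a' b' c' d' e' f' g' h'"
  shows "alternating_image a b c d e f g h"
proof -
  note len = conj_system_lengths[OF sys]
  note sys2 = sys[unfolded conj_system_rotate2[of a]] sys[unfolded conj_system_rotate4[of a]]
    sys[unfolded conj_system_rotate4[of a] conj_system_rotate2[of e]]
  obtain v1 where v1: "b @ v1 = hat g @ a" "v1 @ b = c @ hat e"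
    by (rule conj_system_complement[OF sys]) (use short in simp_all)
  obtain v3 where v3: "d @ v3 = hat a @ c" "v3 @ d = e @ hat g"
    by (rule conj_system_complement[OF sys2(1)]) (use short len in simp_all)
  obtain v5 where v5: "f @ v5 = hat c @ e" "v5 @ f = g @ hat a"
    by (rule conj_system_complement[OF sys2(2)]) (use short len in simp_all)
  obtain v7 where v7: "h @ v7 = hat e @ g" "v7 @ h = a @ hat c"
    by (rule conj_system_complement[OF sys2(3)]) (use short len in simp_all)
  have lv: "length b + length v1 = length a + length c" "length d + length v3 = length a + length c"
    "length b + length v5 = length a + length c" "length d + length v7 = length a + length c"
    using len arg_cong[OF v1(1), of length] arg_cong[OF v3(1), of length]
      arg_cong[OF v5(1), of length] arg_cong[OF v7(1), of length] by simp_all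
  have "v1 \<noteq> []" "v3 \<noteq> []" "v5 \<noteq> []" "v7 \<noteq> []"
    using lv short by auto
  note vne = this
  have "length (hat e) + length v1 + length (hat g) + length v3 < length a + length b + length c + length d"
    using lv less len by simp
  with IH[OF conj_system_swap[OF sys v1 v3 v5 v7] convex_corners_swap[OF r sys cv v1 v3 v5 v7 vne]]
  have "alternating_image (hat e) v1 (hat g) v3 (hat a) v5 (hat c) v7"
    by simp
  \<comment> \<open>Complementing is an involution: the complement of \<open>v1\<close> in the new
    system is \<open>b\<close>, and so on.\<close>
  then have "alternating_image (hat (hat a)) b (hat (hat c)) d (hat (hat e)) f (hat (hat g)) h"
    by (rule alternating_image_swap) (use v1 v3 v5 v7 cv in \<open>simp_all add: convex_corners_def\<close>)
  then show ?thesis by simp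
qed

text \<open>Induction on half the total length. Either a block is at least as long as its two
  neighbours together and loses a period, or the blocks of the class with the larger sum are
  complemented, or the sums agree, which is impossible.\<close>

lemma alternating_image_if_convex_corners:
  assumes r: "\<And>x. r (r x) = bar x"
    and "conj_system a b c d e f g h" "convex_corners r a b c d e f g h"
  shows "alternating_image a b c d e f g h"
  using assms(2,3)
proof (induction "length a + length b + length c + length d" arbitrary: a b c d e f g h rule: less_induct)
  case less
  note sys0 = less.prems(1) and cv0 = less.prems(2)
  note len = conj_system_lengths[OF sys0]
  note sys1 = sys0[unfolded conj_system_rotate[of a]] and cv1 = cv0[unfolded convex_corners_rotate[of r a]]
  note sys2 = sys0[unfolded conj_system_rotate2[of a]] and cv2 = cv0[unfolded convex_corners_rotate2[of r a]]
  note sys3 = sys2[unfolded conj_system_rotate[of c]] and cv3 = cv2[unfolded convex_corners_rotate[of r c]]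
  have ne: "a \<noteq> []" "b \<noteq> []" "c \<noteq> []" "d \<noteq> []"
    using cv0 unfolding convex_corners_def by simp_all
  consider (a) "length h + length b \<le> length a" | (b) "length a + length c \<le> length b"
    | (c) "length b + length d \<le> length c" | (d) "length c + length e \<le> length d"
    | (odd) "length b < length a + length c" "length d < length a + length c"
        "length a + length c < length b + length d"
    | (even) "length a < length b + length d" "length c < length b + length d"
        "length b + length d < length a + length c"
    | (eq) "length a + length c = length b + length d"
    unfolding len by (metis add.commute linorder_neqE_nat not_less)
  then show ?case
  proof cases
    case a
    show ?thesis
      by (rule alternating_image_of_long_block[OF r sys0 cv0 a]) (use less.hyps in simp_all)
  next
    case b
    have "alternating_image b c d e f g h a"
      by (rule alternating_image_of_long_block[OF r sys1 cv1 b]) (use less.hyps len in simp_all)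
    then show ?thesis by (simp only: alternating_image_rotate[of a])
  next
    case c
    have "alternating_image c d e f g h a b"
      by (rule alternating_image_of_long_block[OF r sys2 cv2 c]) (use less.hyps len in simp_all)
    then show ?thesis by (simp only: alternating_image_rotate[of a] alternating_image_rotate[of b])
  next
    case d
    have "alternating_image d e f g h a b c"
      by (rule alternating_image_of_long_block[OF r sys3 cv3 d]) (use less.hyps len in simp_all)
    then show ?thesis
      by (simp only: alternating_image_rotate[of a] alternating_image_rotate[of b] alternating_image_rotate[of c])
  next
    case odd
    show ?thesis
      by (rule alternating_image_of_short_blocks[OF r sys0 cv0 odd]) (use less.hyps in simp_all)
  next
    case even
    have "alternating_image b c d e f g h a"
      by (rule alternating_image_of_short_blocks[OF r sys1 cv1]) (use even less.hyps len in simp_all)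
    then show ?thesis by (simp only: alternating_image_rotate[of a])
  next
    case eq
    note opp = convex_corners_opposite_hd[OF r sys0 cv0] convex_corners_opposite_hd[OF r sys1 cv1]
      convex_corners_opposite_hd[OF r sys2 cv2] convex_corners_opposite_hd[OF r sys3 cv3]
    \<comment> \<open>Some block is no longer than either neighbour. By
      \<open>conj_system_balanced_lengths_eq\<close> it equals its opposite block, although their
      first letters are conjugate.\<close>
    have "length c \<le> length b \<and> length c \<le> length d \<or> length d \<le> length c \<and> length d \<le> length a
      \<or> length a \<le> length d \<and> length a \<le> length b \<or> length b \<le> length a \<and> length b \<le> length c"
      using eq by linarith
    then consider "length c \<le> length b" "length c \<le> length d" | "length d \<le> length c" "length d \<le> length a"
      | "length a \<le> length d" "length a \<le> length b" | "length b \<le> length a" "length b \<le> length c"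
      by blast
    then show ?thesis
    proof cases
      case 1
      with eq have "c = g"
        by (intro conj_system_balanced_lengths_eq[OF sys0])
      with opp(1) bar_neq show ?thesis by metis
    next
      case 2
      with eq have "d = h"
        by (intro conj_system_balanced_lengths_eq[OF sys1]) (simp_all add: len)
      with opp(2) bar_neq show ?thesis by metis
    next
      case 3
      with eq have "e = a"
        by (intro conj_system_balanced_lengths_eq[OF sys2]) (simp_all add: len)
      with opp(3) bar_neq show ?thesis by metis
    next
      case 4
      with eq have "f = b"
        by (intro conj_system_balanced_lengths_eq[OF sys3]) (simp_all add: len)
      with opp(4) bar_neq show ?thesis by metis
    qed
  qed
qed

section \<open>The total turn of a simple lattice polygon\<close>

definition dx :: "letter \<Rightarrow> int" where
  "dx a = (case a of East \<Rightarrow> 1 | West \<Rightarrow> -1 | _ \<Rightarrow> 0)"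

definition dy :: "letter \<Rightarrow> int" where
  "dy a = (case a of North \<Rightarrow> 1 | South \<Rightarrow> -1 | _ \<Rightarrow> 0)"

lemma dx_simps [simp]: "dx East = 1" "dx West = -1" "dx North = 0" "dx South = 0"
  and dy_simps [simp]: "dy North = 1" "dy South = -1" "dy East = 0" "dy West = 0"
  by (simp_all add: dx_def dy_def)

fun left :: "letter \<Rightarrow> letter" where
  "left East = North"
| "left North = West"
| "left West = South"
| "left South = East"

definition turn :: "letter \<Rightarrow> letter \<Rightarrow> int" where
  "turn a b = (if b = left a then 1 else if a = left b then -1 else 0)"

text \<open>
  The number of signed crossings of the ray from \<open>(1/2, 1/2)\<close> eastwards by the unit step from \<open>(x, y)\<close>
  to a point at height \<open>z\<close>. It counts the windings around the origin of paths that avoid the origin.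
\<close>

definition cross :: "int \<Rightarrow> int \<Rightarrow> int \<Rightarrow> int" where
  "cross x y z = (if x \<ge> 1 then of_bool (z \<ge> 1) - of_bool (y \<ge> 1) else 0)"

text \<open>Crossings cancel around a possibly degenerate lattice cell without a corner at the
  origin: the only unit square that encloses the start of the ray has the origin as a
  corner.\<close>

lemma cross_cell:
  assumes "x \<noteq> 0 \<or> y \<noteq> 0" "x - dx a \<noteq> 0 \<or> y - dy a \<noteq> 0" "x + dx b \<noteq> 0 \<or> y + dy b \<noteq> 0"
    "x - dx a + dx b \<noteq> 0 \<or> y - dy a + dy b \<noteq> 0"
  shows "cross x y (y + dy b) + cross (x + dx b) (y + dy b) (y - dy a + dy b) =
    cross x y (y - dy a) + cross (x - dx a) (y - dy a) (y - dy a + dy b)"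
  using assms by (cases a; cases b) (auto simp: cross_def)

text \<open>Crossings while the vector of \<open>a\<close> moves to that of \<open>b\<close> by way
  of their sum, as the secant over one edge passes into the secant over the next.\<close>

definition corner_cross :: "letter \<Rightarrow> letter \<Rightarrow> int" where
  "corner_cross a b = cross (dx a) (dy a) (dy a + dy b) + cross (dx a + dx b) (dy a + dy b) (dy b)"

text \<open>The angle in quarter turns. It jumps just above \<open>East\<close>, where the ray of
  \<open>cross\<close> runs, hence 4 and not 0 for \<open>East\<close>; each crossing then accounts
  for a full turn in \<open>turn_eq_corner_cross\<close>.\<close>

definition direction :: "letter \<Rightarrow> int" where
  "direction a = (case a of North \<Rightarrow> 1 | West \<Rightarrow> 2 | South \<Rightarrow> 3 | East \<Rightarrow> 4)"

lemma turn_eq_corner_cross: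
  "b \<noteq> bar a \<Longrightarrow> turn a b = 4 * corner_cross a b - direction a + direction b"
  by (cases a; cases b) (simp_all add: turn_def corner_cross_def cross_def direction_def)

text \<open>The edges are indexed periodically, so that factors of the circular word become
  intervals of indices.\<close>

locale simple_loop =
  fixes f :: "nat \<Rightarrow> letter" and n :: nat
  assumes n: "n \<ge> 4"
    and periodic: "f (i + n) = f i"
    and simple: "i < j \<Longrightarrow> j < i + n \<Longrightarrow> (\<Sum>l\<in>{i..<j}. dx (f l)) \<noteq> 0 \<or> (\<Sum>l\<in>{i..<j}. dy (f l)) \<noteq> 0"
    and closed: "(\<Sum>l<n. dx (f l)) = 0" "(\<Sum>l<n. dy (f l)) = 0"
begin

definition X :: "nat \<Rightarrow> int" where "X i = (\<Sum>l<i. dx (f l))"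
definition Y :: "nat \<Rightarrow> int" where "Y i = (\<Sum>l<i. dy (f l))"

lemma X_Suc [simp]: "X (Suc i) = X i + dx (f i)" and Y_Suc [simp]: "Y (Suc i) = Y i + dy (f i)"
  and X_0 [simp]: "X 0 = 0" and Y_0 [simp]: "Y 0 = 0" and X_n [simp]: "X n = 0" and Y_n [simp]: "Y n = 0"
  using closed by (simp_all add: X_def Y_def)

lemma distinct_points: "i < j \<Longrightarrow> j < i + n \<Longrightarrow> X j - X i \<noteq> 0 \<or> Y j - Y i \<noteq> 0"
proof -
  assume "i < j" "j < i + n"
  moreover have "X j - X i = (\<Sum>l\<in>{i..<j}. dx (f l))" "Y j - Y i = (\<Sum>l\<in>{i..<j}. dy (f l))"
    using sum_diff_nat_ivl[of 0 i j] \<open>i < j\<close>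
    by (simp_all add: X_def Y_def lessThan_atLeast0)
  ultimately show ?thesis using simple by simp
qed

lemma no_backtrack: "f (Suc i) \<noteq> bar (f i)"
  using distinct_points[of i "i + 2"] n by (cases "f i") auto

text \<open>
  Crossings of the secant from \<open>p\<^sub>i\<close> to \<open>p\<^sub>j\<close> when its end (\<open>cR\<close>) or its start (\<open>cU\<close>) moves by one step.
\<close>

definition cR :: "nat \<Rightarrow> nat \<Rightarrow> int" where
  "cR i j = cross (X j - X i) (Y j - Y i) (Y (Suc j) - Y i)"

definition cU :: "nat \<Rightarrow> nat \<Rightarrow> int" where
  "cU i j = cross (X j - X i) (Y j - Y i) (Y j - Y (Suc i))"

lemma cell:
  assumes "Suc i < j" "Suc j < i + n"
  shows "cR i j + cU i (Suc j) = cU i j + cR (Suc i) j"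
proof -
  have "cross (X j - X i) (Y j - Y i) (Y j - Y i + dy (f j)) +
      cross (X j - X i + dx (f j)) (Y j - Y i + dy (f j)) (Y j - Y i - dy (f i) + dy (f j)) =
    cross (X j - X i) (Y j - Y i) (Y j - Y i - dy (f i)) +
      cross (X j - X i - dx (f i)) (Y j - Y i - dy (f i)) (Y j - Y i - dy (f i) + dy (f j))"
    using assms distinct_points[of i j] distinct_points[of i "Suc j"] distinct_points[of "Suc i" j]
      distinct_points[of "Suc i" "Suc j"]
    by (intro cross_cell) (auto simp: algebra_simps)
  then show ?thesis
    by (simp add: cR_def cU_def algebra_simps)
qed

lemma strip:
  assumes "a \<le> m" "m < j" "Suc j < a + n"
  shows "cR a j + (\<Sum>i\<in>{a..<m}. cU i (Suc j)) = (\<Sum>i\<in>{a..<m}. cU i j) + cR m j"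
  using assms
proof (induction m rule: dec_induct)
  case (step m)
  then show ?case using cell[of m j] by simp
qed simp

text \<open>
  The secants from \<open>p\<^sub>i\<close> to \<open>p\<^sub>j\<close>, \<open>i < j\<close>, never vanish, so that their direction turns by the same
  amount along the diagonal of the triangle of index pairs and along its two legs.
\<close>

lemma diagonal_eq_legs:
  assumes "Suc k < n"
  shows "(\<Sum>i<k. corner_cross (f i) (f (Suc i))) = (\<Sum>j\<in>{1..<Suc k}. cR 0 j) + (\<Sum>i<k. cU i (Suc k))"
  using assms
proof (induction k)
  case (Suc k)
  have "cR 0 (Suc k) + (\<Sum>i<k. cU i (Suc (Suc k))) = (\<Sum>i<k. cU i (Suc k)) + cR k (Suc k)"
    using strip[of 0 k "Suc k"] Suc.prems by (simp add: lessThan_atLeast0)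
  moreover have "corner_cross (f k) (f (Suc k)) = cR k (Suc k) + cU k (Suc (Suc k))"
    by (simp add: corner_cross_def cR_def cU_def)
  ultimately show ?case
    using Suc by simp
qed simp

text \<open>The secant from the first to the last vertex of a closed path vanishes, so the cell at
  that corner of the triangle is left out. The boundary goes around it through the index pairs
  \<open>(0, n - 1)\<close>, \<open>(1, n - 1)\<close> and \<open>(1, n)\<close>.\<close>

lemma diagonal_eq_legs_full:
  "(\<Sum>i<n - 1. corner_cross (f i) (f (Suc i))) =
    (\<Sum>j\<in>{1..<n - 1}. cR 0 j) + cU 0 (n - 1) + cR 1 (n - 1) + (\<Sum>i\<in>{1..<n - 1}. cU i n)"
proof -
  define m where "m = n - 3"
  then have m: "n = m + 3" "m \<ge> 1" using n by simp_all
  have "cR 1 (m + 2) + (\<Sum>i\<in>{1..<m + 1}. cU i (m + 3)) = (\<Sum>i\<in>{1..<m + 1}. cU i (m + 2)) + cR (m + 1) (m + 2)"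
    using strip[of 1 "m + 1" "m + 2"] m by (simp add: numeral_3_eq_3)
  moreover have "corner_cross (f (m + 1)) (f (m + 2)) = cR (m + 1) (m + 2) + cU (m + 1) (m + 3)"
    by (simp add: corner_cross_def cR_def cU_def numeral_3_eq_3)
  moreover have "(\<Sum>i<m + 1. corner_cross (f i) (f (Suc i))) =
      (\<Sum>j\<in>{1..<m + 2}. cR 0 j) + (\<Sum>i<m + 1. cU i (m + 2))"
    using diagonal_eq_legs[of "m + 1"] m by simp
  moreover have "(\<Sum>i<m + 1. cU i (m + 2)) = cU 0 (m + 2) + (\<Sum>i\<in>{1..<m + 1}. cU i (m + 2))"
    by (simp add: lessThan_atLeast0 sum.atLeast_Suc_lessThan)
  ultimately show ?thesis
    unfolding m by (simp add: numeral_3_eq_3)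
qed

text \<open>Hopf's argument for the theorem of turning tangents, with the path started at its
  leftmost lowest vertex. Secants out of this vertex stay in the closed upper half plane and secants
  into it in the lower one, so the crossings along the legs are known.\<close>

lemma total_turn_lowest:
  assumes lowest: "\<And>i. Y i > 0 \<or> Y i = 0 \<and> X i \<ge> 0"
  shows "\<bar>\<Sum>i<n. turn (f i) (f (Suc i))\<bar> = 4"
proof -
  define h :: "nat \<Rightarrow> int" where "h i = of_bool (Y i \<ge> 1)" for i
  \<comment> \<open>Left of the ray \<open>h\<close> is constant as well: a vertical step between
    heights 0 and 1 with \<open>X j \<le> 0\<close> would touch the starting vertex.\<close>
  have "cR 0 j = h (Suc j) - h j" if "j \<in> {1..<n - 1}" for j
  proof (cases "X j \<ge> 1")
    case False
    have "0 < j" "Suc j < n" using that by auto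
    then have "X j \<noteq> 0 \<or> Y j \<noteq> 0" "X (Suc j) \<noteq> 0 \<or> Y (Suc j) \<noteq> 0"
      using distinct_points[of 0 j] distinct_points[of 0 "Suc j"] by simp_all
    with False lowest[of j] lowest[of "Suc j"] have "h (Suc j) = h j"
      by (cases "f j") (auto simp: h_def)
    with False show ?thesis by (simp add: cR_def cross_def)
  qed (simp add: cR_def cross_def h_def)
  then have "(\<Sum>j\<in>{1..<n - 1}. cR 0 j) = (\<Sum>j\<in>{1..<n - 1}. h (Suc j) - h j)"
    by simp
  also have "\<dots> = h (n - 1) - h 1"
    using n by (intro sum_Suc_diff') simp
  finally have legs: "(\<Sum>j\<in>{1..<n - 1}. cR 0 j) = h (n - 1) - h 1" .
  \<comment> \<open>These secants end at the lowest vertex, so they never reach the height of the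
    ray.\<close>
  have "cU i n = 0" for i
    using lowest[of i] lowest[of "Suc i"] by (auto simp: cU_def cross_def)
  then have diag: "(\<Sum>i<n - 1. corner_cross (f i) (f (Suc i))) =
      h (n - 1) - h 1 + cU 0 (n - 1) + cR 1 (n - 1)"
    using diagonal_eq_legs_full legs by simp
  have n1: "n = Suc (n - 1)" using n by simp
  have last: "X (n - 1) = - dx (f (n - 1))" "Y (n - 1) = - dy (f (n - 1))"
    using X_Suc[of "n - 1"] Y_Suc[of "n - 1"] n by simp_all
  have "f n = f 0" using periodic[of 0] by simp
  have "f (n - 1) = West \<or> f (n - 1) = South"
    using lowest[of "n - 1"] last by (cases "f (n - 1)") auto
  moreover have "f 0 = East \<or> f 0 = North"
    using lowest[of 1] by (cases "f 0") auto
  moreover have "f 0 \<noteq> bar (f (n - 1))"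
    using no_backtrack[of "n - 1"] n1 \<open>f n = f 0\<close> by simp
  \<comment> \<open>The first case is a counterclockwise path, the second a clockwise one.\<close>
  ultimately have "f 0 = East \<and> f (n - 1) = South \<or> f 0 = North \<and> f (n - 1) = West"
    by auto
  then have "\<bar>(\<Sum>i<n - 1. corner_cross (f i) (f (Suc i))) + corner_cross (f (n - 1)) (f n)\<bar> = 1"
    unfolding diag \<open>f n = f 0\<close>
  proof
    assume *: "f 0 = East \<and> f (n - 1) = South"
    then have "Suc (n - 1) = n" "X (n - 1) = 0" "Y (n - 1) = 1" "X 1 = 1" "Y 1 = 0"
      using last n1 by (simp_all add: X_Suc[of 0, simplified] Y_Suc[of 0, simplified])
    with * show "\<bar>h (n - 1) - h 1 + cU 0 (n - 1) + cR 1 (n - 1) + corner_cross (f (n - 1)) (f 0)\<bar> = 1"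
      by (simp add: h_def cU_def cR_def cross_def corner_cross_def)
  next
    assume *: "f 0 = North \<and> f (n - 1) = West"
    then have "Suc (n - 1) = n" "X (n - 1) = 1" "Y (n - 1) = 0" "X 1 = 0" "Y 1 = 1"
      using last n1 by (simp_all add: X_Suc[of 0, simplified] Y_Suc[of 0, simplified])
    with * show "\<bar>h (n - 1) - h 1 + cU 0 (n - 1) + cR 1 (n - 1) + corner_cross (f (n - 1)) (f 0)\<bar> = 1"
      by (simp add: h_def cU_def cR_def cross_def corner_cross_def)
  qed
  moreover have "(\<Sum>i<n. corner_cross (f i) (f (Suc i))) =
      (\<Sum>i<n - 1. corner_cross (f i) (f (Suc i))) + corner_cross (f (n - 1)) (f n)"
    using n1 sum.lessThan_Suc[of "\<lambda>i. corner_cross (f i) (f (Suc i))" "n - 1"] by simp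
  ultimately have cc: "\<bar>\<Sum>i<n. corner_cross (f i) (f (Suc i))\<bar> = 1"
    by simp
  have "(\<Sum>i<n. turn (f i) (f (Suc i))) =
      (\<Sum>i<n. 4 * corner_cross (f i) (f (Suc i)) + (direction (f (Suc i)) - direction (f i)))"
    by (rule sum.cong) (simp_all add: turn_eq_corner_cross no_backtrack)
  also have "\<dots> = 4 * (\<Sum>i<n. corner_cross (f i) (f (Suc i)))"
    using \<open>f n = f 0\<close> sum_lessThan_telescope[of "\<lambda>i. direction (f i)" n]
    by (simp add: sum.distrib sum_distrib_left)
  finally show ?thesis
    using cc by (simp add: abs_mult)
qed

lemma X_add_n: "X (i + n) = X i" and Y_add_n: "Y (i + n) = Y i"
  by (induction i) (simp_all add: periodic)

lemma X_mod: "X (i mod n) = X i" and Y_mod: "Y (i mod n) = Y i"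
proof -
  have "X (i + m * n) = X i \<and> Y (i + m * n) = Y i" for i m
    by (induction m) (simp_all add: X_add_n Y_add_n add.assoc[symmetric] add.commute[of n])
  from this[of "i mod n" "i div n"] show "X (i mod n) = X i" "Y (i mod n) = Y i"
    by simp_all
qed

text \<open>The path is restarted at its leftmost lowest vertex; the sum of the turns over one
  period does not depend on the start.\<close>

lemma total_turn: "\<bar>\<Sum>i<n. turn (f i) (f (Suc i))\<bar> = 4"
proof -
  define ymin where "ymin = Min (Y ` {..<n})"
  define xmin where "xmin = Min (X ` {i \<in> {..<n}. Y i = ymin})"
  have "ymin \<in> Y ` {..<n}"
    unfolding ymin_def using n by (intro Min_in) (auto simp: lessThan_empty_iff)
  then have "X ` {i \<in> {..<n}. Y i = ymin} \<noteq> {}"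
    by auto
  then have "xmin \<in> X ` {i \<in> {..<n}. Y i = ymin}"
    unfolding xmin_def by (intro Min_in) auto
  then obtain k where k: "X k = xmin" "Y k = ymin"
    by auto
  have low: "Y i > Y k \<or> Y i = Y k \<and> X i \<ge> X k" for i
  proof -
    have "i mod n < n" using n by simp
    then have "Y (i mod n) \<ge> ymin"
      unfolding ymin_def by simp
    moreover have "X (i mod n) \<ge> xmin" if "Y (i mod n) = ymin"
      unfolding xmin_def using that \<open>i mod n < n\<close> by (intro Min_le) auto
    ultimately show ?thesis
      unfolding k X_mod Y_mod by fastforce
  qed
  have XY: "X (k + i) - X k = (\<Sum>l<i. dx (f (k + l)))" "Y (k + i) - Y k = (\<Sum>l<i. dy (f (k + l)))" for i
    by (induction i) simp_all
  interpret s: simple_loop "\<lambda>i. f (k + i)" n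
  proof
    fix i j :: nat
    assume "i < j" "j < i + n"
    have sh: "(\<Sum>l\<in>{i..<j}. g (k + l)) = (\<Sum>l\<in>{k + i..<k + j}. g l)" for g :: "nat \<Rightarrow> int"
      using sum.shift_bounds_nat_ivl[of g i k j] by (simp add: add.commute)
    show "(\<Sum>l\<in>{i..<j}. dx (f (k + l))) \<noteq> 0 \<or> (\<Sum>l\<in>{i..<j}. dy (f (k + l))) \<noteq> 0"
      using simple[of "k + i" "k + j"] \<open>i < j\<close> \<open>j < i + n\<close>
      by (simp add: sh[of "\<lambda>l. dx (f l)"] sh[of "\<lambda>l. dy (f l)"])
  qed (use n periodic XY[of n, symmetric] in \<open>simp_all add: X_add_n Y_add_n add.assoc[symmetric]\<close>)
  have "s.X i = X (k + i) - X k" "s.Y i = Y (k + i) - Y k" for i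
    by (simp_all add: s.X_def s.Y_def XY)
  then have "\<bar>\<Sum>i<n. turn (f (k + i)) (f (k + Suc i))\<bar> = 4"
    using s.total_turn_lowest low[of "k + _"] by simp
  moreover have "(\<Sum>i<n. turn (f (j + i)) (f (j + Suc i))) = (\<Sum>i<n. turn (f i) (f (Suc i)))" for j
  proof (induction j)
    case (Suc j)
    have "(\<Sum>i<n. turn (f (Suc j + i)) (f (Suc j + Suc i))) + turn (f j) (f (Suc j))
      = (\<Sum>i<Suc n. turn (f (j + i)) (f (j + Suc i)))"
      by (subst sum.lessThan_Suc_shift) simp
    also have "\<dots> = (\<Sum>i<n. turn (f (j + i)) (f (j + Suc i))) + turn (f j) (f (Suc j))"
      using periodic[of j] periodic[of "Suc j"] by simp
    finally show ?case using Suc by simp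
  qed simp
  ultimately show ?thesis by simp
qed

end

section \<open>Corners and nested factorizations\<close>

abbreviation sdx :: "letter list \<Rightarrow> int" where "sdx w \<equiv> sum_list (map dx w)"
abbreviation sdy :: "letter list \<Rightarrow> int" where "sdy w \<equiv> sum_list (map dy w)"

lemma displacement_eq_counts:
  "sdx w = int (count_list w East) - int (count_list w West)"
  "sdy w = int (count_list w North) - int (count_list w South)"
proof (induction w)
  case (Cons x w)
  { case 1 then show ?case using Cons by (cases x) simp_all }
  { case 2 then show ?case using Cons by (cases x) simp_all }
qed simp_all

lemma balanced_iff: "balanced w \<longleftrightarrow> sdx w = 0 \<and> sdy w = 0"
  unfolding balanced_def displacement_eq_counts by auto

lemma displacement_hat [simp]: "sdx (hat w) = - sdx w" "sdy (hat w) = - sdy w"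
proof (induction w)
  case (Cons x w)
  have "hat (x # w) = hat w @ [bar x]" by (simp add: hat_def)
  note h = this
  { case 1 then show ?case using Cons h by (cases x) simp_all }
  { case 2 then show ?case using Cons h by (cases x) simp_all }
qed simp_all

lemma displacement_letter_subst:
  "sdx (letter_subst p q w) = sdx p * sdx w + sdx q * sdy w"
  "sdy (letter_subst p q w) = sdy p * sdx w + sdy q * sdy w"
proof (induction w)
  case (Cons x w)
  { case 1 then show ?case using Cons by (cases x) (simp_all add: letter_image_def algebra_simps) }
  { case 2 then show ?case using Cons by (cases x) (simp_all add: letter_image_def algebra_simps) }
qed simp_all

lemma circ_factor_rotate [simp]: "circ_factor Q (rotate k P) \<longleftrightarrow> circ_factor Q P"
proof
  assume "circ_factor Q P"
  then obtain j where j: "sublist Q (rotate j P)"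
    unfolding circ_factor_def by blast
  show "circ_factor Q (rotate k P)"
  proof (cases "P = []")
    case False
    define m where "m = j + (length P - k mod length P)"
    have "(m + k) mod length P = (j + (length P - k mod length P) + k mod length P) mod length P"
      unfolding m_def by (simp add: mod_add_right_eq)
    also have "(length P - k mod length P) + k mod length P = length P"
      using False by simp
    then have "j + (length P - k mod length P) + k mod length P = j + length P"
      by simp
    finally have "rotate m (rotate k P) = rotate j P"
      unfolding rotate_rotate by (metis mod_add_self2 rotate_conv_mod)
    with j show ?thesis
      unfolding circ_factor_def by metis
  qed (use j in \<open>auto simp: circ_factor_def\<close>)
qed (auto simp: circ_factor_def rotate_rotate)

lemma balanced_append_commute: "balanced (u @ v) \<longleftrightarrow> balanced (v @ u)"
  by (simp add: balanced_iff add.commute)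

lemma balanced_rotate [simp]: "balanced (rotate k w) \<longleftrightarrow> balanced w"
  by (metis append_take_drop_id balanced_append_commute rotate_drop_take)

lemma boundary_word_rotate: "boundary_word P \<Longrightarrow> boundary_word (rotate k P)"
  unfolding boundary_word_def by simp

lemma boundary_word_append_commute: "boundary_word (u @ v) \<Longrightarrow> boundary_word (v @ u)"
  using boundary_word_rotate[of "u @ v" "length u"] by (simp add: rotate_append)

lemma boundary_word_not_balanced:
  assumes "boundary_word (u @ Q @ v)" "Q \<noteq> []" "u @ v \<noteq> []"
  shows "\<not> balanced Q"
proof -
  have "circ_factor Q (u @ Q @ v)"
    unfolding circ_factor_def by (rule exI[of _ 0]) simp
  with assms show ?thesis
    unfolding boundary_word_def by simp
qed

section \<open>Turns along linear and circular words\<close>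

fun open_turn :: "letter list \<Rightarrow> int" where
  "open_turn (x # y # w) = turn x y + open_turn (y # w)"
| "open_turn _ = 0"

definition closed_turn :: "letter list \<Rightarrow> int" where
  "closed_turn w = open_turn w + turn (last w) (hd w)"

lemma open_turn_append:
  "u \<noteq> [] \<Longrightarrow> v \<noteq> [] \<Longrightarrow> open_turn (u @ v) = open_turn u + turn (last u) (hd v) + open_turn v"
proof (induction u rule: open_turn.induct)
  case ("2_2" x)
  then show ?case by (cases v) simp_all
qed simp_all

lemma turn_bar: "turn (bar b) (bar a) = - turn a b"
  by (cases a; cases b) (simp_all add: turn_def)

lemma open_turn_hat [simp]: "open_turn (hat w) = - open_turn w"
proof (induction w rule: open_turn.induct)
  case (1 x y w)
  have "hat (x # y # w) = hat (y # w) @ [bar x]" by (simp add: hat_def)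
  then show ?case
    using 1 by (simp add: open_turn_append last_hat turn_bar)
qed (simp_all add: hat_def)

lemma closed_turn_append_commute: "closed_turn (u @ v) = closed_turn (v @ u)"
  by (cases "u = []"; cases "v = []") (simp_all add: closed_turn_def open_turn_append)

lemma open_turn_eq_sum: "open_turn w = (\<Sum>i<length w - 1. turn (w ! i) (w ! Suc i))"
proof (induction w rule: open_turn.induct)
  case (1 x y w)
  then show ?case by (simp add: sum.lessThan_Suc_shift del: sum.lessThan_Suc)
qed simp_all

section \<open>Factors of a circular word given by positions\<close>

definition cyclic_nth :: "'a list \<Rightarrow> nat \<Rightarrow> 'a" where
  "cyclic_nth P i = P ! (i mod length P)"

definition arc :: "'a list \<Rightarrow> nat \<Rightarrow> nat \<Rightarrow> 'a list" where
  "arc P s t = map (cyclic_nth P) [s..<t]"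

lemma length_arc [simp]: "length (arc P s t) = t - s"
  by (simp add: arc_def)

lemma arc_eq_Nil_iff [simp]: "arc P s t = [] \<longleftrightarrow> t \<le> s"
  by (auto simp: arc_def)

lemma arc_append: "s \<le> t \<Longrightarrow> t \<le> u \<Longrightarrow> arc P s t @ arc P t u = arc P s u"
  unfolding arc_def by (metis le_Suc_ex map_append upt_add_eq_append)

lemma arc_periodic [simp]: "arc P (s + length P) (t + length P) = arc P s t"
proof (rule nth_equalityI)
  fix i
  assume "i < length (arc P (s + length P) (t + length P))"
  moreover have "cyclic_nth P (s + length P + i) = cyclic_nth P (s + i + length P)"
    by (simp add: add.commute add.left_commute)
  ultimately show "arc P (s + length P) (t + length P) ! i = arc P s t ! i"
    by (simp add: arc_def) (simp add: cyclic_nth_def)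
qed simp

lemma rotate_eq_arc: "rotate k P = arc P k (k + length P)"
  by (rule nth_equalityI) (simp_all add: arc_def nth_rotate cyclic_nth_def)

lemma circ_factor_arc:
  assumes "t \<le> s + length P"
  shows "circ_factor (arc P s t) P"
proof (cases "s \<le> t")
  case True
  have "rotate s P = [] @ arc P s t @ arc P t (s + length P)"
    unfolding rotate_eq_arc using assms True by (simp add: arc_append)
  then show ?thesis
    unfolding circ_factor_def sublist_def by blast
next
  case False
  then show ?thesis
    by (simp add: circ_factor_def arc_def)
qed

lemma closed_turn_boundary_word:
  assumes "boundary_word P"
  shows "\<bar>closed_turn P\<bar> = 4"
proof -
  define f where "f = cyclic_nth P"
  define n where "n = length P"
  have n: "n \<ge> 4" and bal: "balanced P"
    and fac: "\<And>Q. circ_factor Q P \<Longrightarrow> Q \<noteq> [] \<Longrightarrow> length Q < n \<Longrightarrow> \<not> balanced Q"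
    using assms unfolding boundary_word_def n_def by blast+
  have sums: "(\<Sum>l\<in>{i..<j}. dx (f l)) = sdx (arc P i j)" "(\<Sum>l\<in>{i..<j}. dy (f l)) = sdy (arc P i j)" for i j
    by (simp_all add: arc_def f_def interv_sum_list_conv_sum_set_nat o_def)
  have P: "arc P 0 n = P"
    using rotate_eq_arc[of 0 P] by (simp add: n_def)
  interpret simple_loop f n
  proof
    show "f (i + n) = f i" for i by (simp add: f_def n_def cyclic_nth_def)
    show "(\<Sum>l\<in>{i..<j}. dx (f l)) \<noteq> 0 \<or> (\<Sum>l\<in>{i..<j}. dy (f l)) \<noteq> 0" if "i < j" "j < i + n" for i j
    proof -
      have "circ_factor (arc P i j) P"
        using that by (intro circ_factor_arc) (simp add: n_def)
      with fac[of "arc P i j"] that show ?thesis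
        unfolding sums balanced_iff by auto
    qed
    show "(\<Sum>l<n. dx (f l)) = 0" "(\<Sum>l<n. dy (f l)) = 0"
      using bal unfolding lessThan_atLeast0 sums P balanced_iff by simp_all
  qed (rule n)
  have ne: "P \<noteq> []" using n by (auto simp: n_def)
  have "open_turn P = (\<Sum>i<n - 1. turn (f i) (f (Suc i)))"
    unfolding open_turn_eq_sum n_def by (rule sum.cong) (simp_all add: f_def cyclic_nth_def)
  moreover have "turn (last P) (hd P) = turn (f (n - 1)) (f (Suc (n - 1)))"
    using ne n by (simp add: f_def cyclic_nth_def last_conv_nth hd_conv_nth n_def)
  ultimately have "closed_turn P = (\<Sum>i<Suc (n - 1). turn (f i) (f (Suc i)))"
    by (simp add: closed_turn_def)
  with total_turn n show ?thesis by simp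
qed

text \<open>Turns inside a word cancel against those inside its \<open>hat\<close>, so the four
  corners alone add up to \<open>T\<close>, which is 4 or -4. As each of them is at most 1 in
  absolute value, all four are equal.\<close>

lemma square_corners:
  assumes bw: "boundary_word (A @ B @ hat A @ hat B)" and ne: "A \<noteq> []" "B \<noteq> []"
  defines "T \<equiv> closed_turn (A @ B @ hat A @ hat B)"
  shows "4 * turn (last A) (hd B) = T" "4 * turn (last B) (hd (hat A)) = T"
    "4 * turn (last (hat A)) (hd (hat B)) = T" "4 * turn (last (hat B)) (hd A) = T"
proof -
  have "T = turn (last A) (hd B) + turn (last B) (hd (hat A)) + turn (last (hat A)) (hd (hat B)) +
      turn (last (hat B)) (hd A)"
    unfolding T_def closed_turn_def using ne by (simp add: open_turn_append)
  moreover have "turn x y \<in> {-1, 0, 1}" for x y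
    by (simp add: turn_def)
  then have "turn (last A) (hd B) \<in> {-1, 0, 1}" "turn (last B) (hd (hat A)) \<in> {-1, 0, 1}"
    "turn (last (hat A)) (hd (hat B)) \<in> {-1, 0, 1}" "turn (last (hat B)) (hd A) \<in> {-1, 0, 1}"
    by blast+
  moreover have "\<bar>T\<bar> = 4"
    unfolding T_def by (rule closed_turn_boundary_word[OF bw])
  ultimately show "4 * turn (last A) (hd B) = T" "4 * turn (last B) (hd (hat A)) = T"
    "4 * turn (last (hat A)) (hd (hat B)) = T" "4 * turn (last (hat B)) (hd A) = T"
    by auto
qed

text \<open>The block \<open>X\<close> of one factorization lies inside the block
  \<open>C @ X @ D\<close> of another. If \<open>C\<close> and \<open>D\<close> differ in length, a
  balanced proper factor appears; if not, the total turn would be zero.\<close>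

lemma nested_factorizations_impossible:
  assumes bw: "boundary_word (C @ X @ D @ B @ C' @ hat X @ D' @ hat B)"
    and len: "length C' = length C" "length D' = length D"
    and eq1: "hat D @ hat X @ hat C = C' @ hat X @ D'"
    and eq2: "hat C' @ hat B @ hat D = D' @ hat B @ C"
    and ne: "X \<noteq> []" "B \<noteq> []" "C \<noteq> [] \<or> D \<noteq> []"
  shows False
proof -
  have eq1': "C @ X @ D = hat D' @ X @ hat C'"
    using arg_cong[OF eq1, of hat] by simp
  consider "length C < length D" | "length D < length C" | "length C = length D"
    by linarith
  then show False
  proof cases
    case 1
    obtain H where H: "D' = hat C' @ H" "hat B @ hat D = H @ hat B @ C"
      using append_eq_append_leD[OF eq2[symmetric]] len 1 by auto
    obtain K where K: "H @ hat B = hat B @ K" "hat D = K @ C"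
      using append_eq_append_leD[of "H @ hat B" C "hat B" "hat D"] H(2) by auto
    have "K \<noteq> []"
      using 1 arg_cong[OF K(2), of length] by auto
    have "C @ X @ D @ B @ C' @ hat X @ D' @ hat B =
        (hat D' @ X @ hat C') @ B @ C' @ hat X @ hat C' @ H @ hat B"
      using eq1' H(1) by simp
    \<comment> \<open>In the middle factor every word is matched by its \<open>hat\<close>, so it is
      balanced; it is proper because \<open>K\<close> is nonempty.\<close>
    also have "\<dots> = hat H @ (C' @ X @ hat C' @ B @ C' @ hat X @ hat C' @ hat B) @ K"
      unfolding K(1) H(1) by simp
    finally show False
      using boundary_word_not_balanced[of "hat H" "C' @ X @ hat C' @ B @ C' @ hat X @ hat C' @ hat B" K]
        bw ne \<open>K \<noteq> []\<close> by (simp add: balanced_iff)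
  next
    case 2
    obtain K where K: "hat C' = D' @ K" "hat B @ C = K @ hat B @ hat D"
      using append_eq_append_leD[OF eq2] len 2 by auto
    obtain H where H: "K @ hat B = hat B @ H" "C = H @ hat D"
      using append_eq_append_leD[of "K @ hat B" "hat D" "hat B" C] K(2) by auto
    have "H \<noteq> []"
      using 2 arg_cong[OF H(2), of length] by auto
    \<comment> \<open>Here the circular word must be read from another starting point before the
      balanced factor shows.\<close>
    have "C @ X @ D @ B @ C' @ hat X @ D' @ hat B = C @ X @ D @ B @ (hat D @ hat X @ hat C) @ hat B"
      unfolding eq1 by simp
    also have "\<dots> = (H @ hat D @ X @ D @ B @ hat D @ hat X @ D) @ hat H @ hat B"
      unfolding H(2) by simp
    finally have "boundary_word ((hat H @ hat B) @ H @ hat D @ X @ D @ B @ hat D @ hat X @ D)"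
      using bw boundary_word_append_commute by metis
    also have "(hat H @ hat B) @ H @ hat D @ X @ D @ B @ hat D @ hat X @ D =
        (hat H @ K) @ (hat B @ hat D @ X @ D @ B @ hat D @ hat X @ D) @ []"
      using H(1) by simp
    finally show False
      using boundary_word_not_balanced[of "hat H @ K" "hat B @ hat D @ X @ D @ B @ hat D @ hat X @ D" "[]"]
        ne \<open>H \<noteq> []\<close> by (simp add: balanced_iff)
  next
    case 3
    have "hat D = C'" "hat C = D'"
      using eq1 len 3 by simp_all
    moreover have "hat C' = D'"
      using eq2 len 3 by simp
    ultimately have C: "C = hat D" "C' = hat D" "D' = D"
      by auto
    then have "D \<noteq> []" using ne by auto
    define A Y where "A = hat D @ X @ D" and "Y = D @ B @ hat D"
    have bwA: "boundary_word (A @ B @ hat A @ hat B)"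
      using bw unfolding C A_def by simp
    have rot: "boundary_word (X @ Y @ hat X @ hat Y)"
      using boundary_word_append_commute[of "hat D" "X @ D @ B @ hat D @ hat X @ D @ hat B"] bw
      unfolding C Y_def by simp
    have T: "closed_turn (X @ Y @ hat X @ hat Y) = closed_turn (A @ B @ hat A @ hat B)"
      using closed_turn_append_commute[of "hat D" "X @ D @ B @ hat D @ hat X @ D @ hat B"]
      by (simp add: A_def Y_def)
    have "A \<noteq> []" "Y \<noteq> []" using ne by (simp_all add: A_def Y_def)
    define t where "t = closed_turn (A @ B @ hat A @ hat B)"
    note corners = square_corners[OF bwA \<open>A \<noteq> []\<close> ne(2)] square_corners[OF rot ne(1) \<open>Y \<noteq> []\<close>]
    \<comment> \<open>By the two factorizations each of the eight junctions turns by a quarter of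
      \<open>t\<close>. All other turns cancel, so the eight must also add up to
      \<open>t\<close>.\<close>
    have "4 * t = 8 * t"
      using corners ne \<open>D \<noteq> []\<close> unfolding T t_def[symmetric]
      by (simp add: t_def closed_turn_def A_def Y_def open_turn_append)
    then have "t = 0" by simp
    with closed_turn_boundary_word[OF bwA] show False
      by (simp add: t_def)
  qed
qed

section \<open>The two factorizations of a prime double square\<close>

text \<open>Read from \<open>a\<close> and from \<open>b\<close>, the word has two square
  factorizations whose corners together are all eight block boundaries. By
  \<open>square_corners\<close> all of them turn the same way.\<close>

lemma convex_corners_of_boundary_word:
  assumes bw: "boundary_word (a @ b @ c @ d @ e @ f @ g @ h)" and sys: "conj_system a b c d e f g h"
    and ne: "a \<noteq> []" "b \<noteq> []" "c \<noteq> []" "d \<noteq> []"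
  obtains r where "\<And>x. r (r x) = bar x" "convex_corners r a b c d e f g h"
proof -
  have hats: "hat (a @ b) = e @ f" "hat (c @ d) = g @ h" "hat (b @ c) = f @ g" "hat (d @ e) = h @ a"
    using sys unfolding conj_system_def by simp_all
  have nes: "e \<noteq> []" "f \<noteq> []" "g \<noteq> []" "h \<noteq> []"
    using conj_system_lengths[OF sys] ne by auto
  define T where "T = closed_turn (a @ b @ c @ d @ e @ f @ g @ h)"
  have P: "(a @ b) @ (c @ d) @ hat (a @ b) @ hat (c @ d) = a @ b @ c @ d @ e @ f @ g @ h"
    unfolding hats by simp
  have Q: "(b @ c) @ (d @ e) @ hat (b @ c) @ hat (d @ e) = (b @ c @ d @ e @ f @ g @ h) @ a"
    unfolding hats by simp
  have bwQ: "boundary_word ((b @ c @ d @ e @ f @ g @ h) @ a)"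
    using bw by (rule boundary_word_append_commute)
  have TQ: "closed_turn ((b @ c @ d @ e @ f @ g @ h) @ a) = T"
    unfolding T_def by (rule closed_turn_append_commute)
  note corners = square_corners[of "a @ b" "c @ d", unfolded P, unfolded hats, OF bw, folded T_def]
    square_corners[of "b @ c" "d @ e", unfolded Q, unfolded hats, OF bwQ, unfolded TQ]
  have turns: "4 * turn (last b) (hd c) = T" "4 * turn (last d) (hd e) = T" "4 * turn (last f) (hd g) = T"
    "4 * turn (last h) (hd a) = T" "4 * turn (last c) (hd d) = T" "4 * turn (last e) (hd f) = T"
    "4 * turn (last g) (hd h) = T" "4 * turn (last a) (hd b) = T"
    using corners ne nes by simp_all
  \<comment> \<open>\<open>bar (left x)\<close> is the right turn, for a path traversed
    clockwise.\<close>
  define r where "r x = (if T = 4 then left x else bar (left x))" for x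
  have rr: "r (r x) = bar x" for x
    by (cases x) (simp_all add: r_def)
  have "T = 4 \<or> T = -4"
    using closed_turn_boundary_word[OF bw] unfolding T_def by linarith
  then have r: "y = r x" if "4 * turn x y = T" for x y
    using that by (cases x; cases y) (auto simp: r_def turn_def split: if_splits)
  have "convex_corners r a b c d e f g h"
    unfolding convex_corners_def using turns[THEN r] ne nes by simp
  with rr that show thesis by blast
qed

section \<open>Pulling back boundary words and applying primality\<close>

lemma letter_subst_eq_Nil_iff: "p \<noteq> [] \<Longrightarrow> q \<noteq> [] \<Longrightarrow> letter_subst p q w = [] \<longleftrightarrow> w = []"
  by (cases w) (auto simp: letter_image_def split: letter.splits)

lemma homologous_morphism_letter_subst: "homologous_morphism (letter_subst p q)"
  unfolding homologous_morphism_def by simp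

text \<open>A substitution acts linearly on displacements, so a balanced proper factor of
  \<open>U\<close> would have a balanced proper factor of the image as its own image.\<close>

lemma boundary_word_of_letter_subst:
  assumes bw: "boundary_word (letter_subst p q U)" and ne: "p \<noteq> []" "q \<noteq> []"
    and U: "length U \<ge> 4" "balanced U"
  shows "boundary_word U"
  unfolding boundary_word_def
proof (intro conjI allI impI; (elim conjE)?)
  fix Q
  assume Q: "circ_factor Q U" "Q \<noteq> []" "length Q < length U"
  then obtain k u v where k: "rotate k U = u @ Q @ v"
    unfolding circ_factor_def sublist_def by blast
  have "letter_subst p q U = letter_subst p q (take (k mod length U) U) @ letter_subst p q (drop (k mod length U) U)"
    by (metis append_take_drop_id letter_subst_append)
  moreover have "letter_subst p q (rotate k U) =
      letter_subst p q (drop (k mod length U) U) @ letter_subst p q (take (k mod length U) U)"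
    by (simp add: rotate_drop_take)
  ultimately have "boundary_word (letter_subst p q u @ letter_subst p q Q @ letter_subst p q v)"
    using bw boundary_word_append_commute k by simp
  moreover have "u @ v \<noteq> []"
    using Q(3) arg_cong[OF k, of length] by auto
  then have "letter_subst p q u @ letter_subst p q v \<noteq> []" "letter_subst p q Q \<noteq> []"
    using Q(2) ne by (simp_all add: letter_subst_eq_Nil_iff)
  ultimately have "\<not> balanced (letter_subst p q Q)"
    by (intro boundary_word_not_balanced)
  then show "\<not> balanced Q"
    by (auto simp: balanced_iff displacement_letter_subst)
qed (use U in simp_all)

text \<open>In an alternating word of even length the last and the first letter also differ in kind,
  so alternation survives wrapping around.\<close>

lemma alternating_rotate:
  assumes "alternating s w" "even (length w)"
  obtains t where "alternating t (rotate k w)"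
proof -
  have "\<exists>t. alternating t (rotate k w)"
  proof (induction k)
    case (Suc k)
    then obtain t where "alternating t (rotate k w)" by blast
    moreover have "even (length (rotate k w))" using assms by simp
    ultimately have "\<exists>t. alternating t (rotate1 (rotate k w))"
      by (cases "rotate k w") auto
    then show ?case by simp
  qed (use assms in auto)
  with that show thesis by blast
qed

lemma alternating_no_square:
  assumes "alternating s w" "even (length w)"
  shows "\<not> circ_factor [x, x] w"
proof
  assume "circ_factor [x, x] w"
  then obtain k u v where k: "rotate k w = u @ [x, x] @ v"
    unfolding circ_factor_def sublist_def by blast
  obtain t where "alternating t (rotate k w)"
    using alternating_rotate[OF assms] .
  then show False unfolding k by auto
qed

text \<open>The preimage \<open>U\<close> is too long for the simple square, so primality makes it
  an isometric copy of \<open>P\<close>. As a circular word it alternates, hence has no two equal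
  adjacent letters.\<close>

lemma prime_no_square_if_alternating_factorizations:
  assumes prime: "prime_double_square P"
    and P: "rotate k P = a @ b @ c @ d @ e @ f @ g @ h" and sys: "conj_system a b c d e f g h"
    and ne: "a \<noteq> []" "b \<noteq> []" "c \<noteq> []" "d \<noteq> []"
  shows "\<not> circ_factor [\<alpha>, \<alpha>] P"
proof
  assume square: "circ_factor [\<alpha>, \<alpha>] P"
  have "boundary_word P"
    and minimal: "\<And>\<phi> U. homologous_morphism \<phi> \<Longrightarrow> boundary_word U \<Longrightarrow> circ_eq P (\<phi> U) \<Longrightarrow>
      same_boundary U P \<or> same_boundary U simple_square"
    using prime unfolding prime_double_square_def double_square_def by simp_all
  then have bw: "boundary_word (a @ b @ c @ d @ e @ f @ g @ h)"
    using boundary_word_rotate[of P k] P by simp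
  obtain r where r: "\<And>x. r (r x) = bar x" and "convex_corners r a b c d e f g h"
    using convex_corners_of_boundary_word[OF bw sys ne] by blast
  from alternating_image_if_convex_corners[OF r sys this(2)] show False
  proof cases
    case (alternating_imageI a' b' c' d' e' f' g' h' p q)
    note im = this(1-8) and sol = this(9) and pq = this(10,11)
    define U where "U = a' @ b' @ c' @ d' @ e' @ f' @ g' @ h'"
    have sys': "conj_system a' b' c' d' e' f' g' h'"
      using sol unfolding alternating_solution_def by blast
    note len = conj_system_lengths[OF sys']
    have PU: "rotate k P = letter_subst p q U"
      unfolding P U_def im by simp
    have "length U \<ge> 8"
    proof -
      have "a' \<noteq> []" "b' \<noteq> []" "c' \<noteq> []" "d' \<noteq> []"
        using ne im by auto
      then have "length a' \<ge> 1" "length b' \<ge> 1" "length c' \<ge> 1" "length d' \<ge> 1"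
        by (simp_all add: Suc_le_eq)
      then show ?thesis
        unfolding U_def using len by simp
    qed
    have "length U = 2 * (length a' + length b' + length c' + length d')"
      unfolding U_def using len by simp
    then have "even (length U)" by simp
    obtain s where s: "alternating s U"
      using sol unfolding alternating_solution_def U_def by blast
    have "balanced U"
    proof -
      have "hat (a' @ b') = e' @ f'" "hat (c' @ d') = g' @ h'"
        using sys' unfolding conj_system_def by simp_all
      then have "U = (a' @ b') @ (c' @ d') @ hat (a' @ b') @ hat (c' @ d')"
        unfolding U_def by simp
      then show ?thesis
        by (simp add: balanced_iff)
    qed
    have "boundary_word (letter_subst p q U)"
      using bw P PU by simp
    then have "boundary_word U"
      using boundary_word_of_letter_subst pq \<open>length U \<ge> 8\<close> \<open>balanced U\<close> by simp
    moreover have "circ_eq P (letter_subst p q U)"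
      unfolding circ_eq_def by (rule exI[of _ k]) (rule PU)
    ultimately have "same_boundary U P \<or> same_boundary U simple_square"
      by (rule minimal[OF homologous_morphism_letter_subst])
    moreover have "\<not> same_boundary U simple_square"
    proof
      assume "same_boundary U simple_square"
      then obtain \<sigma> j where "rotate j (map \<sigma> U) = simple_square"
        unfolding same_boundary_def circ_eq_def by blast
      from arg_cong[OF this, of length] have "length U = length simple_square"
        by simp
      with \<open>length U \<ge> 8\<close> show False
        by (simp add: simple_square_def)
    qed
    ultimately obtain \<sigma> j where \<sigma>: "bij \<sigma>" "rotate j (map \<sigma> U) = P"
      unfolding same_boundary_def circ_eq_def by blast
    \<comment> \<open>Since \<open>\<sigma>\<close> is injective, equal adjacent letters of
      \<open>P\<close> come from equal adjacent letters of \<open>U\<close>.\<close>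
    from square have "circ_factor [\<alpha>, \<alpha>] (map \<sigma> U)"
      unfolding \<sigma>(2)[symmetric] by simp
    then obtain i u v where "map \<sigma> (rotate i U) = u @ [\<alpha>, \<alpha>] @ v"
      unfolding circ_factor_def sublist_def rotate_map by blast
    then obtain u' x y v' where xy: "rotate i U = u' @ [x, y] @ v'" "\<sigma> x = \<alpha>" "\<sigma> y = \<alpha>"
      by (auto simp: map_eq_append_conv map_eq_Cons_conv)
    then have "x = y"
      using injD[OF bij_is_inj[OF \<sigma>(1)], of x y] by simp
    with xy(1) have "circ_factor [x, x] U"
      unfolding circ_factor_def sublist_def by blast
    with alternating_no_square[OF s \<open>even (length U)\<close>] show False
      by blast
  qed
qed

section \<open>Factorizations given by their cut positions\<close>

definition square_cut :: "letter list \<Rightarrow> nat \<Rightarrow> nat \<Rightarrow> nat \<Rightarrow> bool" where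
  "square_cut P L k m \<longleftrightarrow> k < m \<and> m < k + L \<and> hat (arc P k m) = arc P (k + L) (m + L) \<and>
     hat (arc P m (k + L)) = arc P (m + L) (k + 2 * L)"

definition cut_set :: "letter list \<Rightarrow> nat \<Rightarrow> nat \<Rightarrow> nat \<Rightarrow> nat set" where
  "cut_set P L k m = (\<lambda>i. i mod length P) ` {k, m, k + L, m + L}"

text \<open>The same factorization read from its next block. Positions grow beyond the length of
  \<open>P\<close> instead of being reduced, so cuts of two factorizations can be compared by order;
  \<open>L\<close> is half that length.\<close>

lemma square_cut_shift:
  assumes P: "length P = 2 * L" and "square_cut P L k m"
  shows "square_cut P L m (k + L)" "cut_set P L m (k + L) = cut_set P L k m"
proof -
  have "arc P (k + L + L) (m + 2 * L) = arc P k m"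
    using arc_periodic[of P k m] P by (simp add: mult_2 add.assoc)
  moreover have "hat (arc P (k + L) (m + L)) = arc P k m"
    using assms(2) unfolding square_cut_def by (metis hat_hat)
  ultimately show "square_cut P L m (k + L)"
    using assms(2) unfolding square_cut_def by (simp add: mult_2 add.assoc)
  have "(k + (L + L)) mod length P = k mod length P"
    using P by (simp add: mult_2[symmetric])
  then show "cut_set P L m (k + L) = cut_set P L k m"
    unfolding cut_set_def by (auto simp: add.assoc)
qed

text \<open>Shifts block by block until the current block contains position
  \<open>l\<close>.\<close>

lemma square_cut_advance:
  assumes P: "length P = 2 * L" and "square_cut P L k m" "k \<le> l"
  obtains k' m' where "square_cut P L k' m'" "cut_set P L k' m' = cut_set P L k m" "k' \<le> l" "l < m'"
  using assms(2,3)
proof (induction "l - k" arbitrary: k m thesis rule: less_induct)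
  case less
  show ?case
  proof (cases "l < m")
    case False
    have "k < m" using less.prems unfolding square_cut_def by simp
    with False have "l - m < l - k" by simp
    then obtain k' m' where "square_cut P L k' m'" "cut_set P L k' m' = cut_set P L m (k + L)"
      "k' \<le> l" "l < m'"
      using less.hyps[of m "k + L"] square_cut_shift[OF P less.prems(2)] False by auto
    with less.prems(1) square_cut_shift(2)[OF P less.prems(2)] show ?thesis by simp
  qed (use less.prems in blast)
qed

lemma square_cut_not_nested:
  assumes bw: "boundary_word P" and P: "length P = 2 * L"
    and km: "square_cut P L k m" and ll: "square_cut P L l l'"
    and nested: "k \<le> l" "l' \<le> m" "k < l \<or> l' < m"
  shows False
proof (rule nested_factorizations_impossible)
  let ?C = "arc P k l" and ?X = "arc P l l'" and ?D = "arc P l' m" and ?B = "arc P m (k + L)"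
    and ?C' = "arc P (k + L) (l + L)" and ?D' = "arc P (l' + L) (m + L)"
  have lt: "k < m" "m < k + L" "l < l'" "l' < l + L"
    using km ll unfolding square_cut_def by simp_all
  have hX: "hat ?X = arc P (l + L) (l' + L)"
    using ll unfolding square_cut_def by simp
  have hB: "hat ?B = arc P (m + L) (k + 2 * L)"
    using km unfolding square_cut_def by simp
  have "?C @ ?X @ ?D @ ?B @ ?C' @ hat ?X @ ?D' @ hat ?B = arc P k (k + length P)"
    unfolding hX hB using lt nested P by (simp add: arc_append)
  then show "boundary_word (?C @ ?X @ ?D @ ?B @ ?C' @ hat ?X @ ?D' @ hat ?B)"
    using boundary_word_rotate[OF bw, of k] by (simp add: rotate_eq_arc)
  have "hat (?C @ ?X @ ?D) = ?C' @ hat ?X @ ?D'"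
    unfolding hX using km lt nested by (simp add: arc_append square_cut_def del: hat_append)
  then show "hat ?D @ hat ?X @ hat ?C = ?C' @ hat ?X @ ?D'"
    by simp
  have "?C = arc P (k + 2 * L) (l + 2 * L)"
    using arc_periodic[of P k l] P by simp
  then have "?D' @ hat ?B @ ?C = ?D' @ arc P (m + L) (k + 2 * L) @ arc P (k + 2 * L) (l + 2 * L)"
    unfolding hB by simp
  also have "\<dots> = arc P (l' + L) (l + 2 * L)"
    using lt nested by (simp add: arc_append)
  finally have "?D' @ hat ?B @ ?C = arc P (l' + L) (l + 2 * L)" .
  moreover have "hat (?D @ ?B @ ?C') = arc P (l' + L) (l + 2 * L)"
    using ll lt nested by (simp add: arc_append square_cut_def del: hat_append)
  ultimately show "hat ?C' @ hat ?B @ hat ?D = ?D' @ hat ?B @ ?C"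
    by simp
qed (use km ll nested in \<open>auto simp: square_cut_def\<close>)

text \<open>Non-nesting is used three times: \<open>l\<close> to \<open>l'\<close> does not fit into
  \<open>k\<close> to \<open>m\<close>, and neither \<open>k\<close> to \<open>m\<close> nor
  \<open>m\<close> to \<open>k + L\<close> fits into \<open>l\<close> to \<open>l'\<close>.\<close>

lemma square_cut_cases:
  assumes bw: "boundary_word P" and P: "length P = 2 * L"
    and km: "square_cut P L k m" and ll: "square_cut P L l l'"
    and diff: "cut_set P L k m \<noteq> cut_set P L l l'" and "k \<le> l" "l < m"
  shows "k < l \<and> m < l' \<and> l' < k + L"
proof -
  have lt: "k < m" "m < k + L" "l < l'" "l' < l + L"
    using km ll unfolding square_cut_def by simp_all
  have "m < l'"
  proof (rule ccontr)
    assume "\<not> m < l'"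
    then have "l' \<le> m" by simp
    then have "\<not> (k < l \<or> l' < m)"
      using square_cut_not_nested[OF bw P km ll \<open>k \<le> l\<close>] by blast
    with \<open>k \<le> l\<close> \<open>l' \<le> m\<close> have "k = l" "m = l'"
      by linarith+
    with diff show False by simp
  qed
  moreover have "k < l"
    using square_cut_not_nested[OF bw P ll km] \<open>m < l'\<close> \<open>k \<le> l\<close> by force
  moreover have "l' < k + L"
    using square_cut_not_nested[OF bw P ll square_cut_shift(1)[OF P km]] \<open>l < m\<close> by force
  ultimately show ?thesis by blast
qed

lemma square_cut_of_factorization:
  assumes bw: "boundary_word P" and fac: "square_factorization P k A B"
  shows "square_cut P (length P div 2) k (k + length A)"
    "cut_set P (length P div 2) k (k + length A) = cut_positions P k A B"
    "length P = 2 * (length P div 2)"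
proof -
  have rot: "rotate k P = A @ B @ hat A @ hat B"
    using fac unfolding square_factorization_def .
  define L where "L = length A + length B"
  have len: "length P = 2 * L"
    using arg_cong[OF rot, of length] by (simp add: L_def)
  then have half: "length P div 2 = L" by simp
  have bw': "boundary_word (A @ B @ hat A @ hat B)"
    using boundary_word_rotate[OF bw, of k] rot by simp
  \<comment> \<open>An empty \<open>A\<close> or \<open>B\<close> would leave a word that folds back
    at its middle, where a letter meets its conjugate.\<close>
  have no_hat: False if "boundary_word (Q @ hat Q)" for Q
  proof (cases Q rule: rev_cases)
    case (snoc w x)
    then have "boundary_word (w @ [x, bar x] @ hat w)"
      using that by (simp add: hat_def)
    moreover have "w @ hat w \<noteq> []"
    proof
      assume "w @ hat w = []"
      with that snoc show False unfolding boundary_word_def by simp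
    qed
    moreover have "balanced [x, bar x]" by (cases x) (simp_all add: balanced_iff)
    ultimately show False using boundary_word_not_balanced by blast
  qed (use that in \<open>simp add: boundary_word_def\<close>)
  have "A \<noteq> []" "B \<noteq> []"
    using no_hat[of B] no_hat[of A] bw' by auto
  have "arc P k (k + length A) @ arc P (k + length A) (k + L) @
      arc P (k + L) (k + length A + L) @ arc P (k + length A + L) (k + 2 * L) = arc P k (k + 2 * L)"
    by (simp add: arc_append L_def)
  also have "\<dots> = A @ B @ hat A @ hat B"
    using rot rotate_eq_arc[of k P] len by simp
  finally have "arc P k (k + length A) = A" "arc P (k + length A) (k + L) = B"
    "arc P (k + L) (k + length A + L) = hat A" "arc P (k + length A + L) (k + 2 * L) = hat B"
    by (simp_all add: L_def)
  then show "square_cut P (length P div 2) k (k + length A)"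
    unfolding square_cut_def half using \<open>A \<noteq> []\<close> \<open>B \<noteq> []\<close> by (simp add: L_def)
  show "cut_set P (length P div 2) k (k + length A) = cut_positions P k A B"
    unfolding cut_set_def cut_positions_def half by (simp add: L_def ac_simps)
  show "length P = 2 * (length P div 2)"
    using len by simp
qed

lemma conj_system_of_square_cuts:
  assumes P: "length P = 2 * L"
    and km: "square_cut P L k m" and ll: "square_cut P L l l'"
    and ord: "k < l" "l < m" "m < l'" "l' < k + L"
  shows "conj_system (arc P k l) (arc P l m) (arc P m l') (arc P l' (k + L))
      (arc P (k + L) (l + L)) (arc P (l + L) (m + L)) (arc P (m + L) (l' + L)) (arc P (l' + L) (k + 2 * L))"
proof -
  have "arc P k l = arc P (k + 2 * L) (l + 2 * L)"
    using arc_periodic[of P k l] P by simp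
  then have "arc P (l' + L) (k + 2 * L) @ arc P k l = arc P (l' + L) (l + 2 * L)"
    using ord by (simp add: arc_append)
  moreover have "arc P k l @ arc P l m = arc P k m" "arc P l m @ arc P m l' = arc P l l'"
    "arc P m l' @ arc P l' (k + L) = arc P m (k + L)"
    "arc P l' (k + L) @ arc P (k + L) (l + L) = arc P l' (l + L)"
    "arc P (k + L) (l + L) @ arc P (l + L) (m + L) = arc P (k + L) (m + L)"
    "arc P (l + L) (m + L) @ arc P (m + L) (l' + L) = arc P (l + L) (l' + L)"
    "arc P (m + L) (l' + L) @ arc P (l' + L) (k + 2 * L) = arc P (m + L) (k + 2 * L)"
    using ord by (simp_all add: arc_append)
  ultimately show ?thesis
    using km ll unfolding conj_system_def square_cut_def
    by (simp only: hat_append[symmetric]) (metis hat_hat)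
qed

text \<open>Once the first factorization is advanced to the block containing \<open>l\<close>, the
  cuts alternate and bound eight nonempty blocks.\<close>

lemma prime_no_square_if_square_cuts:
  assumes prime: "prime_double_square P" and P: "length P = 2 * L"
    and km: "square_cut P L k m" and ll: "square_cut P L l l'"
    and diff: "cut_set P L k m \<noteq> cut_set P L l l'" and "k \<le> l"
  shows "\<not> circ_factor [\<alpha>, \<alpha>] P"
proof -
  have bw: "boundary_word P"
    using prime unfolding prime_double_square_def double_square_def by blast
  obtain k' m' where k': "square_cut P L k' m'" "cut_set P L k' m' = cut_set P L k m" "k' \<le> l" "l < m'"
    using square_cut_advance[OF P km \<open>k \<le> l\<close>] .
  then have "k' < l \<and> m' < l' \<and> l' < k' + L"
    using square_cut_cases[OF bw P k'(1) ll] diff by simp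
  then have ord: "k' < l" "l < m'" "m' < l'" "l' < k' + L"
    using k' by simp_all
  have "rotate k' P = arc P k' l @ arc P l m' @ arc P m' l' @ arc P l' (k' + L) @
      arc P (k' + L) (l + L) @ arc P (l + L) (m' + L) @ arc P (m' + L) (l' + L) @ arc P (l' + L) (k' + 2 * L)"
    using ord P by (simp add: arc_append rotate_eq_arc)
  from prime_no_square_if_alternating_factorizations[OF prime this conj_system_of_square_cuts[OF P k'(1) ll ord]]
  show ?thesis using ord by simp
qed

theorem theorem5:
  fixes P :: "letter list" and \<alpha> :: letter
  assumes "prime_double_square P"
  shows "\<not> circ_factor [\<alpha>, \<alpha>] P"
proof -
  obtain k A B l X Y where bw: "boundary_word P" and fac: "square_factorization P k A B" "square_factorization P l X Y"
    and diff: "cut_positions P k A B \<noteq> cut_positions P l X Y"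
    using assms unfolding prime_double_square_def double_square_def by blast
  note cut1 = square_cut_of_factorization[OF bw fac(1)] and cut2 = square_cut_of_factorization[OF bw fac(2)]
  have diff': "cut_set P (length P div 2) k (k + length A) \<noteq> cut_set P (length P div 2) l (l + length X)"
    using diff cut1(2) cut2(2) by simp
  show ?thesis
  proof (cases "k \<le> l")
    case True
    then show ?thesis
      using prime_no_square_if_square_cuts[OF assms cut1(3,1) cut2(1) diff'] by simp
  next
    case False
    then show ?thesis
      using prime_no_square_if_square_cuts[OF assms cut1(3) cut2(1) cut1(1) diff'[symmetric]] by simp
  qed
qed

end
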